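(* Let $(E,w)$ be a row-finite weighted graph, $\mathsf{k}$ a field and $n$ a positive integer. Then $L_{\mathsf{k}}(\mathbb{M}_nE,\bar{w})\cong \mathbb{M}_n(L_{\mathsf{k}}(E,w))$ as $\mathsf{k}$-algebras.
   Context: A (directed) graph is a quadruple $E=(E^0,E^1,s,r)$ with sets $E^0$ (vertices) and $E^1$ (edges) and maps $s,r:E^1\to E^0$ (source, range). It is row-finite if each vertex emits finitely many edges ($s^{-1}(v)$ is finite for all $v$). A vertex is a sink if it emits no edges; it is regular if it is not a sink and emits only finitely many edges; $E^0_{\mathrm{reg}}$ is the set of regular vertices. A weighted graph is a pair $(E,w)$ with $E$ a graph and $w:E^1\to\mathbb{N}^+$ a map ($\mathbb{N}^+$ = positive integers); it is row-finite if $E$ is. For $v\in E^0_{\mathrm{reg}}$ set $w(v):=\max\{w(e): e\in s^{-1}(v)\}$. For a row-finite weighted graph $(E,w)$ and a field $\mathsf{k}$, the weighted Leavitt path algebra $L_{\mathsf{k}}(E,w)$ is the (associative, not necessarily unital) $\mathsf{k}$-algebra generated by $\{v,e_i,e_i^*: v\in E^0, e\in E^1, 1\le i\le w(e)\}$ subject to the relations (i) $uv=\delta_{uv}u$ for $u,v\in E^0$; (ii) $s(e)e_i=e_i=e_ir(e)$ and $r(e)e_i^*=e_i^*=e_i^*s(e)$ for $e\in E^1$, $1\le i\le w(e)$; (iii) $\sum_{e\in s^{-1}(v)}e_ie_j^*=\delta_{ij}v$ for $v\in E^0_{\mathrm{reg}}$, $1\le i,j\le w(v)$; (iv) $\sum_{1\le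 i\le w(v)}e_i^*f_i=\delta_{ef}r(e)$ for $v\in E^0_{\mathrm{reg}}$, $e,f\in s^{-1}(v)$; where in (iii),(iv) $e_i$ and $e_i^*$ are set to be zero whenever $i>w(e)$. The weighted graph $(\mathbb{M}_nE,\bar{w})$ is formed from $(E,w)$ by attaching to each $v\in E^0$ a "head" of length $n-1$: for each $v\in E^0$ one adds new vertices $v_1,\dots,v_{n-1}$ and new edges $e^v_1,\dots,e^v_{n-1}$ with $s(e^v_i)=v_i$ and $r(e^v_i)=v_{i-1}$, where $v_0:=v$; $\bar{w}$ extends $w$ with $\bar{w}(e^v_i)=1$ for all $v\in E^0$ and $1\le i\le n-1$. $\mathbb{M}_n(R)$ denotes the ring of $n\times n$ matrices over $R$. *)

theory Defs
  imports
    "Graph_Theory.Digraph"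
    "Jordan_Normal_Form.Matrix"
    "HOL-Algebra.QuotRing"
    "HOL-Library.Poly_Mapping"
begin

section \<open>Weighted graphs\<close>

locale row_finite_weighted_graph = wf_digraph E
  for E :: "('v, 'e) pre_digraph" +
  fixes w :: "'e \<Rightarrow> nat"
  assumes weight_pos: "e \<in> arcs E \<Longrightarrow> 1 \<le> w e"
    and row_finite: "v \<in> verts E \<Longrightarrow> finite (out_arcs E v)"

definition regular_verts :: "('v, 'e) pre_digraph \<Rightarrow> 'v set" where
  "regular_verts E = {v \<in> verts E. out_arcs E v \<noteq> {} \<and> finite (out_arcs E v)}"

definition vertex_weight :: "('v, 'e) pre_digraph \<Rightarrow> ('e \<Rightarrow> nat) \<Rightarrow> 'v \<Rightarrow> nat" where
  "vertex_weight E w v = Max (w ` out_arcs E v)"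

text \<open>
  Attaching heads of length \<open>n - 1\<close>. The pair \<open>(v, i)\<close> is the vertex \<open>v\<^sub>i\<close> of the head at \<open>v\<close>,
  so that \<open>(v, 0)\<close> is \<open>v\<close> itself; \<open>Inl e\<close> is an old edge, and \<open>Inr (v, i)\<close> with
  \<open>1 \<le> i < n\<close> is the new edge from \<open>v\<^sub>i\<close> to \<open>v\<^bsub>i-1\<^esub>\<close>.
\<close>

definition head_graph :: "nat \<Rightarrow> ('v, 'e) pre_digraph \<Rightarrow> ('v \<times> nat, 'e + 'v \<times> nat) pre_digraph" where
  "head_graph n E =
    \<lparr> verts = verts E \<times> {0..<n},
      arcs = Inl ` arcs E \<union> Inr ` (verts E \<times> {1..<n}),
      tail = case_sum (\<lambda>e. (tail E e, 0)) (\<lambda>(v, i). (v, i)),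
      head = case_sum (\<lambda>e. (head E e, 0)) (\<lambda>(v, i). (v, i - 1)) \<rparr>"

definition head_weight :: "('e \<Rightarrow> nat) \<Rightarrow> 'e + 'v \<times> nat \<Rightarrow> nat" where
  "head_weight w = case_sum w (\<lambda>_. 1)"


section \<open>Algebras without unit over a field\<close>

text \<open>
  A not necessarily unital algebra over \<open>'k\<close> is represented by a record of type
  \<open>('k, 'a) module\<close>, whose multiplicative part is used but whose field \<open>one\<close> is ignored:
  it is \<open>undefined\<close> in the algebras constructed below.
\<close>

definition algebra_iso :: "('k, 'a) module \<Rightarrow> ('k, 'b) module \<Rightarrow> ('a \<Rightarrow> 'b) set" where
  "algebra_iso A B =
    {\<phi>. bij_betw \<phi> (carrier A) (carrier B) \<and>
        (\<forall>x \<in> carrier A. \<forall>y \<in> carrier A. \<phi> (x \<oplus>\<^bsub>A\<^esub> y) = \<phi> x \<oplus>\<^bsub>B\<^esub> \<phi> y) \<and>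
        (\<forall>x \<in> carrier A. \<forall>y \<in> carrier A. \<phi> (x \<otimes>\<^bsub>A\<^esub> y) = \<phi> x \<otimes>\<^bsub>B\<^esub> \<phi> y) \<and>
        (\<forall>c. \<forall>x \<in> carrier A. \<phi> (c \<odot>\<^bsub>A\<^esub> x) = c \<odot>\<^bsub>B\<^esub> \<phi> x)}"

definition algebra_isomorphic :: "('k, 'a) module \<Rightarrow> ('k, 'b) module \<Rightarrow> bool" where
  "algebra_isomorphic A B \<longleftrightarrow> algebra_iso A B \<noteq> {}"

definition algebra_ideal :: "('k, 'a) module \<Rightarrow> 'a set \<Rightarrow> bool" where
  "algebra_ideal A I \<longleftrightarrow>
    I \<subseteq> carrier A \<and> \<zero>\<^bsub>A\<^esub> \<in> I \<and>
    (\<forall>x \<in> I. \<forall>y \<in> I. x \<oplus>\<^bsub>A\<^esub> y \<in> I) \<and>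
    (\<forall>c. \<forall>x \<in> I. c \<odot>\<^bsub>A\<^esub> x \<in> I) \<and>
    (\<forall>a \<in> carrier A. \<forall>x \<in> I. a \<otimes>\<^bsub>A\<^esub> x \<in> I \<and> x \<otimes>\<^bsub>A\<^esub> a \<in> I)"

definition generated_algebra_ideal :: "('k, 'a) module \<Rightarrow> 'a set \<Rightarrow> 'a set" where
  "generated_algebra_ideal A S = \<Inter> {I. algebra_ideal A I \<and> S \<subseteq> I}"

definition quotient_algebra :: "('k, 'a) module \<Rightarrow> 'a set \<Rightarrow> ('k, 'a set) module" where
  "quotient_algebra A I =
    \<lparr> carrier = a_rcosets\<^bsub>A\<^esub> I,
      mult = rcoset_mult A I,
      one = undefined,
      zero = I,
      add = set_add A,
      smult = (\<lambda>c X. \<Union>x\<in>X. I +>\<^bsub>A\<^esub> (c \<odot>\<^bsub>A\<^esub> x)) \<rparr>"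

definition matrix_algebra :: "nat \<Rightarrow> ('k, 'a) module \<Rightarrow> ('k, 'a mat) module" where
  "matrix_algebra n A =
    \<lparr> carrier = {M \<in> carrier_mat n n. elements_mat M \<subseteq> carrier A},
      mult = (\<lambda>M N. mat n n (\<lambda>(i, j). \<Oplus>\<^bsub>A\<^esub>l\<in>{0..<n}. M $$ (i, l) \<otimes>\<^bsub>A\<^esub> N $$ (l, j))),
      one = undefined,
      zero = mat n n (\<lambda>(i, j). \<zero>\<^bsub>A\<^esub>),
      add = (\<lambda>M N. mat n n (\<lambda>(i, j). M $$ (i, j) \<oplus>\<^bsub>A\<^esub> N $$ (i, j))),
      smult = (\<lambda>c M. mat n n (\<lambda>(i, j). c \<odot>\<^bsub>A\<^esub> M $$ (i, j))) \<rparr>"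


section \<open>Free algebras\<close>

text \<open>
  With words as a monoid under concatenation, \<open>'g list \<Rightarrow>\<^sub>0 'k\<close> is the monoid ring of the free monoid,
  that is, the ring of noncommutative polynomials in the variables \<open>'g\<close>.
\<close>

instantiation list :: (type) monoid_add
begin

definition zero_list :: "'a list" where "zero_list = []"
definition plus_list :: "'a list \<Rightarrow> 'a list \<Rightarrow> 'a list" where "plus_list xs ys = xs @ ys"

instance
  by standard (simp_all add: zero_list_def plus_list_def)

end

text \<open>The empty word is excluded, as the free algebra has no unit.\<close>

definition free_algebra :: "'g set \<Rightarrow> ('k::field, 'g list \<Rightarrow>\<^sub>0 'k) module" where
  "free_algebra G =
    \<lparr> carrier = {p. \<forall>u \<in> Poly_Mapping.keys p. u \<noteq> [] \<and> set u \<subseteq> G},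
      mult = (*),
      one = undefined,
      zero = 0,
      add = (+),
      smult = (\<lambda>c. Poly_Mapping.map ((*) c)) \<rparr>"


section \<open>Weighted Leavitt path algebras\<close>

text \<open>\<open>Edge e i\<close> and \<open>Ghost e i\<close> stand for \<open>e\<^sub>i\<close> and \<open>e\<^sub>i\<^sup>*\<close>.\<close>

datatype ('v, 'e) gen = Vertex 'v | Edge 'e nat | Ghost 'e nat

definition gens :: "('v, 'e) pre_digraph \<Rightarrow> ('e \<Rightarrow> nat) \<Rightarrow> ('v, 'e) gen set" where
  "gens E w =
    Vertex ` verts E \<union>
    {Edge e i |e i. e \<in> arcs E \<and> 1 \<le> i \<and> i \<le> w e} \<union>
    {Ghost e i |e i. e \<in> arcs E \<and> 1 \<le> i \<and> i \<le> w e}"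

type_synonym ('k, 'v, 'e) gen_poly = "('v, 'e) gen list \<Rightarrow>\<^sub>0 'k"

definition vertex_poly :: "'v \<Rightarrow> ('k::field, 'v, 'e) gen_poly" where
  "vertex_poly v = Poly_Mapping.single [Vertex v] 1"

text \<open>The next two include the convention that \<open>e\<^sub>i = 0 = e\<^sub>i\<^sup>*\<close> for \<open>i > w e\<close>.\<close>

definition edge_poly :: "('e \<Rightarrow> nat) \<Rightarrow> 'e \<Rightarrow> nat \<Rightarrow> ('k::field, 'v, 'e) gen_poly" where
  "edge_poly w e i = (if i \<le> w e then Poly_Mapping.single [Edge e i] 1 else 0)"

definition ghost_poly :: "('e \<Rightarrow> nat) \<Rightarrow> 'e \<Rightarrow> nat \<Rightarrow> ('k::field, 'v, 'e) gen_poly" where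
  "ghost_poly w e i = (if i \<le> w e then Poly_Mapping.single [Ghost e i] 1 else 0)"

inductive_set wlpa_relations ::
  "('v, 'e) pre_digraph \<Rightarrow> ('e \<Rightarrow> nat) \<Rightarrow> ('k::field, 'v, 'e) gen_poly set"
  for E :: "('v, 'e) pre_digraph" and w :: "'e \<Rightarrow> nat"
where
  vertices: "\<lbrakk>u \<in> verts E; v \<in> verts E\<rbrakk> \<Longrightarrow>
    vertex_poly u * vertex_poly v - (if u = v then vertex_poly u else 0) \<in> wlpa_relations E w"
| tail_edge: "\<lbrakk>e \<in> arcs E; 1 \<le> i; i \<le> w e\<rbrakk> \<Longrightarrow>
    vertex_poly (tail E e) * edge_poly w e i - edge_poly w e i \<in> wlpa_relations E w"
| edge_head: "\<lbrakk>e \<in> arcs E; 1 \<le> i; i \<le> w e\<rbrakk> \<Longrightarrow>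
    edge_poly w e i * vertex_poly (head E e) - edge_poly w e i \<in> wlpa_relations E w"
| head_ghost: "\<lbrakk>e \<in> arcs E; 1 \<le> i; i \<le> w e\<rbrakk> \<Longrightarrow>
    vertex_poly (head E e) * ghost_poly w e i - ghost_poly w e i \<in> wlpa_relations E w"
| ghost_tail: "\<lbrakk>e \<in> arcs E; 1 \<le> i; i \<le> w e\<rbrakk> \<Longrightarrow>
    ghost_poly w e i * vertex_poly (tail E e) - ghost_poly w e i \<in> wlpa_relations E w"
| edge_ghost: "\<lbrakk>v \<in> regular_verts E; 1 \<le> i; i \<le> vertex_weight E w v;
      1 \<le> j; j \<le> vertex_weight E w v\<rbrakk> \<Longrightarrow>
    (\<Sum>e\<in>out_arcs E v. edge_poly w e i * ghost_poly w e j) - (if i = j then vertex_poly v else 0)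
      \<in> wlpa_relations E w"
| ghost_edge: "\<lbrakk>v \<in> regular_verts E; e \<in> out_arcs E v; f \<in> out_arcs E v\<rbrakk> \<Longrightarrow>
    (\<Sum>i\<in>{1..vertex_weight E w v}. ghost_poly w e i * edge_poly w f i)
        - (if e = f then vertex_poly (head E e) else 0)
      \<in> wlpa_relations E w"

text \<open>The first argument only carries the field of coefficients, as in \<open>wlpa TYPE('k) E w\<close>.\<close>

definition wlpa ::
  "'k::field itself \<Rightarrow> ('v, 'e) pre_digraph \<Rightarrow> ('e \<Rightarrow> nat) \<Rightarrow> ('k, ('k, 'v, 'e) gen_poly set) module"
where
  "wlpa _ E w =
    quotient_algebra (free_algebra (gens E w))
      (generated_algebra_ideal (free_algebra (gens E w)) (wlpa_relations E w))"

end

theory Submission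
  imports Defs
begin

text \<open>
  Send a generator of the algebra of the extended graph to the matrix with a single nonzero entry: its
  position is given by the indices \<open>i\<close> of the source \<open>v\<^sub>i\<close> and of the range \<open>u\<^sub>j\<close>, and the entry is the
  generator itself for an old generator and the vertex \<open>v\<close> for the generators of the head at \<open>v\<close>.
  The inverse sends the matrix with entry \<open>x\<close> at \<open>(i, j)\<close>, where \<open>x\<close> is a word from \<open>u\<close> to \<open>v\<close>,
  to \<open>p x q\<^sup>*\<close> where \<open>p\<close> is the path from \<open>u\<^sub>i\<close> to \<open>u\<close> and \<open>q\<close> the path from \<open>v\<^sub>j\<close> to \<open>v\<close>.
  Both maps are defined on words of the free algebras, respect the ideals of relations, and are
  inverse to each other modulo them. As there need not be a unit (there may be infinitely many
  vertices), the inverse has to select \<open>p\<close> and \<open>q\<close> by the ends of each word, instead of multiplying by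
  the sum of all paths.
\<close>

section \<open>Linear extension\<close>

text \<open>Scalars are written as \<open>Poly_Mapping.single 0 c\<close>, multiples of the neutral
  element of the monoid. Scaling is then multiplication in the monoid ring, which has a unit
  although the free algebra inside it has none.\<close>

definition linear_extension :: "('a \<Rightarrow> ('b::monoid_add \<Rightarrow>\<^sub>0 'k::field)) \<Rightarrow> ('a \<Rightarrow>\<^sub>0 'k) \<Rightarrow> ('b \<Rightarrow>\<^sub>0 'k)" where
  "linear_extension f p = (\<Sum>u\<in>Poly_Mapping.keys p. Poly_Mapping.single 0 (Poly_Mapping.lookup p u) * f u)"

text \<open>Terms outside the support vanish, so polynomials with different supports can be summed
  over a common index set.\<close>

lemma linear_extension_superset:
  assumes "finite A" "Poly_Mapping.keys p \<subseteq> A"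
  shows "linear_extension f p = (\<Sum>u\<in>A. Poly_Mapping.single 0 (Poly_Mapping.lookup p u) * f u)"
  unfolding linear_extension_def
  by (rule sum.mono_neutral_left) (use assms in \<open>auto dest: not_in_keys_iff_lookup_eq_zero[THEN iffD1]\<close>)

lemma linear_extension_zero [simp]: "linear_extension f 0 = 0"
  by (simp add: linear_extension_def)

lemma linear_extension_single [simp]:
  "linear_extension f (Poly_Mapping.single u c) = Poly_Mapping.single 0 c * f u"
  by (subst linear_extension_superset[where A="{u}"]) auto

lemma linear_extension_add: "linear_extension f (p + q) = linear_extension f p + linear_extension f q"
proof -
  let ?A = "Poly_Mapping.keys p \<union> Poly_Mapping.keys q"
  have "linear_extension f (p + q) = (\<Sum>u\<in>?A. Poly_Mapping.single 0 (Poly_Mapping.lookup (p + q) u) * f u)"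
    by (rule linear_extension_superset) (auto simp: Poly_Mapping.keys_add)
  moreover have "linear_extension f p = (\<Sum>u\<in>?A. Poly_Mapping.single 0 (Poly_Mapping.lookup p u) * f u)"
    by (rule linear_extension_superset) auto
  moreover have "linear_extension f q = (\<Sum>u\<in>?A. Poly_Mapping.single 0 (Poly_Mapping.lookup q u) * f u)"
    by (rule linear_extension_superset) auto
  ultimately show ?thesis
    by (simp add: lookup_add single_add distrib_right sum.distrib)
qed

lemma linear_extension_diff:
  "linear_extension f (p - q) = linear_extension f p - linear_extension f q"
proof -
  have "linear_extension f (p - q) + linear_extension f q = linear_extension f p"
    by (simp flip: linear_extension_add)
  then show ?thesis
    by (simp add: eq_diff_eq)
qed

lemma linear_extension_sum:
  "linear_extension f (\<Sum>x\<in>A. p x) = (\<Sum>x\<in>A. linear_extension f (p x))"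
  by (induction A rule: infinite_finite_induct) (auto simp: linear_extension_add)

lemma sum_single_keys:
  fixes p :: "'a \<Rightarrow>\<^sub>0 'b::comm_monoid_add"
  shows "(\<Sum>u\<in>Poly_Mapping.keys p. Poly_Mapping.single u (Poly_Mapping.lookup p u)) = p"
proof (rule poly_mapping_eqI)
  fix k
  have "Poly_Mapping.lookup (\<Sum>u\<in>Poly_Mapping.keys p. Poly_Mapping.single u (Poly_Mapping.lookup p u)) k
      = (\<Sum>u\<in>Poly_Mapping.keys p. if u = k then Poly_Mapping.lookup p k else 0)"
    unfolding lookup_sum lookup_single when_def by (rule sum.cong) auto
  then show "Poly_Mapping.lookup (\<Sum>u\<in>Poly_Mapping.keys p. Poly_Mapping.single u (Poly_Mapping.lookup p u)) k = Poly_Mapping.lookup p k"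
    using not_in_keys_iff_lookup_eq_zero[of k p] by auto
qed

text \<open>Scalars are central: the neutral element of the monoid commutes with every monomial,
  although words do not commute with each other.\<close>

lemma single_times_comm:
  fixes p :: "'b::monoid_add \<Rightarrow>\<^sub>0 'k::comm_ring_1"
  shows "Poly_Mapping.single 0 c * p = p * Poly_Mapping.single 0 c"
proof -
  have "Poly_Mapping.single 0 c * (\<Sum>u\<in>Poly_Mapping.keys p. Poly_Mapping.single u (Poly_Mapping.lookup p u))
      = (\<Sum>u\<in>Poly_Mapping.keys p. Poly_Mapping.single u (Poly_Mapping.lookup p u)) * Poly_Mapping.single 0 c"
    by (simp add: sum_distrib_left sum_distrib_right mult_single mult.commute)
  then show ?thesis
    by (simp only: sum_single_keys)
qed

lemma linear_extension_scale:
  "linear_extension f (Poly_Mapping.single 0 c * p) = Poly_Mapping.single 0 c * linear_extension f p"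
proof -
  have "linear_extension f (Poly_Mapping.single 0 c * (\<Sum>u\<in>Poly_Mapping.keys p. Poly_Mapping.single u (Poly_Mapping.lookup p u)))
      = Poly_Mapping.single 0 c * linear_extension f (\<Sum>u\<in>Poly_Mapping.keys p. Poly_Mapping.single u (Poly_Mapping.lookup p u))"
    by (simp add: sum_distrib_left linear_extension_sum mult_single flip: mult.assoc)
  then show ?thesis
    by (simp only: sum_single_keys)
qed

text \<open>Fixed factors on both sides can be pulled out of the sum because scalars are central. It
  serves for polynomials all of whose words are wrapped by the same two paths.\<close>

lemma linear_extension_sandwich:
  assumes "\<And>u. u \<in> Poly_Mapping.keys p \<Longrightarrow> f u = a * g u * b"
  shows "linear_extension f p = a * linear_extension g p * b"
proof -
  have "Poly_Mapping.single 0 c * (a * x * b) = a * (Poly_Mapping.single 0 c * x) * b" for c x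
    by (metis mult.assoc single_times_comm)
  then show ?thesis
    using assms by (simp add: linear_extension_def sum_distrib_left sum_distrib_right)
qed

section \<open>Ideals and quotients of free algebras\<close>

abbreviation word :: "'g list \<Rightarrow> 'g list \<Rightarrow>\<^sub>0 'k::field" where
  "word u \<equiv> Poly_Mapping.single u 1"

abbreviation words :: "'g set \<Rightarrow> 'g list set" where
  "words G \<equiv> {u. u \<noteq> [] \<and> set u \<subseteq> G}"

lemma word_times_word: "word u * word v = word (u @ v)"
  by (simp add: mult_single plus_list_def)

lemma scale_word: "Poly_Mapping.single 0 c * word u = Poly_Mapping.single u c"
  by (simp add: mult_single)

lemma free_algebra_carrier: "p \<in> carrier (free_algebra G) \<longleftrightarrow> Poly_Mapping.keys p \<subseteq> words G"
  by (auto simp: free_algebra_def)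

lemma free_algebra_simps [simp]:
  "mult (free_algebra G) = (*)"
  "zero (free_algebra G) = 0"
  "add (free_algebra G) = (+)"
  "c \<odot>\<^bsub>free_algebra G\<^esub> p = Poly_Mapping.single 0 c * p"
  by (simp_all add: free_algebra_def zero_list_def mult_map_scale_conv_mult)

lemma
  shows free_algebra_single: "u \<in> words G \<Longrightarrow> Poly_Mapping.single u c \<in> carrier (free_algebra G)"
    and free_algebra_zero: "0 \<in> carrier (free_algebra G)"
    and free_algebra_add: "p \<in> carrier (free_algebra G) \<Longrightarrow> q \<in> carrier (free_algebra G) \<Longrightarrow>
          p + q \<in> carrier (free_algebra G)"
    and free_algebra_mult: "p \<in> carrier (free_algebra G) \<Longrightarrow> q \<in> carrier (free_algebra G) \<Longrightarrow>
          p * q \<in> carrier (free_algebra G)"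
    and free_algebra_diff: "p \<in> carrier (free_algebra G) \<Longrightarrow> q \<in> carrier (free_algebra G) \<Longrightarrow>
          p - q \<in> carrier (free_algebra G)"
proof -
  show "u \<in> words G \<Longrightarrow> Poly_Mapping.single u c \<in> carrier (free_algebra G)"
    by (auto simp: free_algebra_carrier)
  show "0 \<in> carrier (free_algebra G)"
    by (auto simp: free_algebra_carrier)
  show "p \<in> carrier (free_algebra G) \<Longrightarrow> q \<in> carrier (free_algebra G) \<Longrightarrow>
      p + q \<in> carrier (free_algebra G)"
    using Poly_Mapping.keys_add[of p q] unfolding free_algebra_carrier by blast
  show "p \<in> carrier (free_algebra G) \<Longrightarrow> q \<in> carrier (free_algebra G) \<Longrightarrow>
      p - q \<in> carrier (free_algebra G)"
    using keys_diff[of p q] unfolding free_algebra_carrier by blast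
  show "p * q \<in> carrier (free_algebra G)"
    if "p \<in> carrier (free_algebra G)" "q \<in> carrier (free_algebra G)"
    unfolding free_algebra_carrier
  proof
    fix u assume "u \<in> Poly_Mapping.keys (p * q)"
    then obtain a b where "u = a @ b" "a \<in> Poly_Mapping.keys p" "b \<in> Poly_Mapping.keys q"
      using keys_mult[of p q] by (auto simp: plus_list_def)
    then show "u \<in> words G"
      using that by (force simp: free_algebra_carrier)
  qed
qed

lemma free_algebra_sum:
  "(\<And>x. x \<in> A \<Longrightarrow> p x \<in> carrier (free_algebra G)) \<Longrightarrow> (\<Sum>x\<in>A. p x) \<in> carrier (free_algebra G)"
  by (induction A rule: infinite_finite_induct) (auto intro: free_algebra_zero free_algebra_add)

lemma free_algebra_scale:
  "p \<in> carrier (free_algebra G) \<Longrightarrow> Poly_Mapping.single 0 c * p \<in> carrier (free_algebra G)"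
  unfolding free_algebra_carrier
  using keys_mult[of "Poly_Mapping.single 0 c" p] by (fastforce split: if_splits)

lemma free_algebra_induct [consumes 1, case_names zero add single]:
  assumes p: "p \<in> carrier (free_algebra G)"
    and zero: "P 0"
    and add: "\<And>p q. P p \<Longrightarrow> P q \<Longrightarrow> P (p + q)"
    and single: "\<And>u c. u \<in> words G \<Longrightarrow> P (Poly_Mapping.single u c)"
  shows "P p"
proof -
  \<comment> \<open>The induction runs over subsets of the support, so that each word met is known
    to be in \<open>words G\<close>.\<close>
  have "P (\<Sum>u\<in>A. Poly_Mapping.single u (Poly_Mapping.lookup p u))" if "finite A" "A \<subseteq> Poly_Mapping.keys p" for A
    using that
  proof (induction A rule: finite_induct)
    case (insert u A)
    then have "u \<in> words G"
      using p by (auto simp: free_algebra_carrier)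
    then show ?case
      using insert by (auto intro!: add single)
  qed (simp add: zero)
  from this[of "Poly_Mapping.keys p"] show ?thesis
    by (simp add: sum_single_keys)
qed

lemma linear_extension_closed:
  assumes "p \<in> carrier (free_algebra G)" "\<And>u. u \<in> words G \<Longrightarrow> f u \<in> carrier (free_algebra H)"
  shows "linear_extension f p \<in> carrier (free_algebra H)"
  using assms(1)
  by (induction rule: free_algebra_induct)
    (auto simp: linear_extension_add assms(2) intro: free_algebra_zero free_algebra_add free_algebra_scale)

section \<open>Ideals of free algebras\<close>

lemma algebra_ideal_carrier: "algebra_ideal (free_algebra G) (carrier (free_algebra G))"
  by (auto simp: algebra_ideal_def intro: free_algebra_zero free_algebra_add free_algebra_mult free_algebra_scale)

text \<open>Since the whole carrier is an ideal containing \<open>S\<close>, the intersection that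
  defines the generated ideal runs over a nonempty family and stays inside the carrier.\<close>

lemma algebra_ideal_generated:
  assumes "S \<subseteq> carrier (free_algebra G)"
  shows "algebra_ideal (free_algebra G) (generated_algebra_ideal (free_algebra G) S)"
proof -
  have "generated_algebra_ideal (free_algebra G) S \<subseteq> carrier (free_algebra G)"
    unfolding generated_algebra_ideal_def using assms algebra_ideal_carrier by blast
  then show ?thesis
    unfolding algebra_ideal_def generated_algebra_ideal_def by simp
qed

lemma generated_algebra_ideal_incl: "S \<subseteq> generated_algebra_ideal A S"
  by (auto simp: generated_algebra_ideal_def)

lemma generated_algebra_ideal_minimal:
  "algebra_ideal A I \<Longrightarrow> S \<subseteq> I \<Longrightarrow> generated_algebra_ideal A S \<subseteq> I"
  by (auto simp: generated_algebra_ideal_def)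

locale free_algebra_ideal =
  fixes G :: "'g set" and J :: "('g list \<Rightarrow>\<^sub>0 'k::field) set"
  assumes ideal: "algebra_ideal (free_algebra G) J"
begin

lemma ideal_subset: "J \<subseteq> carrier (free_algebra G)"
  using ideal by (simp add: algebra_ideal_def)

lemma ideal_zero: "0 \<in> J"
  using ideal by (simp add: algebra_ideal_def)

lemma ideal_add: "x \<in> J \<Longrightarrow> y \<in> J \<Longrightarrow> x + y \<in> J"
  using ideal by (simp add: algebra_ideal_def)

lemma ideal_scale: "x \<in> J \<Longrightarrow> Poly_Mapping.single 0 c * x \<in> J"
  using ideal by (simp add: algebra_ideal_def)

lemma ideal_lmult: "a \<in> carrier (free_algebra G) \<Longrightarrow> x \<in> J \<Longrightarrow> a * x \<in> J"
  using ideal by (simp add: algebra_ideal_def)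

lemma ideal_rmult: "a \<in> carrier (free_algebra G) \<Longrightarrow> x \<in> J \<Longrightarrow> x * a \<in> J"
  using ideal by (simp add: algebra_ideal_def)

lemma ideal_uminus: "x \<in> J \<Longrightarrow> - x \<in> J"
  using ideal_scale[of x "-1"] by (simp add: single_uminus)

lemma ideal_diff: "x \<in> J \<Longrightarrow> y \<in> J \<Longrightarrow> x - y \<in> J"
  using ideal_add[of x "- y"] ideal_uminus by simp

lemma ideal_sum: "(\<And>x. x \<in> A \<Longrightarrow> f x \<in> J) \<Longrightarrow> (\<Sum>x\<in>A. f x) \<in> J"
  by (induction A rule: infinite_finite_induct) (auto simp: ideal_zero ideal_add)

lemma ideal_diff_sym: "x - y \<in> J \<Longrightarrow> y - x \<in> J"
  using ideal_uminus[of "x - y"] by simp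

lemma ideal_diff_trans: "x - y \<in> J \<Longrightarrow> y - z \<in> J \<Longrightarrow> x - z \<in> J"
  using ideal_add[of "x - y" "y - z"] by simp

text \<open>The contexts \<open>a\<close> and \<open>b\<close> may be empty. The empty word is the
  unit of the monoid ring and lies outside the free algebra, so absorption does not cover it and it
  is treated apart.\<close>

lemma ideal_word_mult:
  assumes "x \<in> J" "set a \<subseteq> G" "set b \<subseteq> G"
  shows "word a * x * word b \<in> J"
proof -
  have "word a * x \<in> J"
    using assms ideal_lmult[of "word a" x] free_algebra_single[of a G]
    by (cases "a = []") (auto simp flip: zero_list_def)
  then show ?thesis
    using assms ideal_rmult[of "word b" "word a * x"] free_algebra_single[of b G]
    by (cases "b = []") (auto simp flip: zero_list_def)
qed

lemma word_null_context:
  "word u \<in> J \<Longrightarrow> set a \<subseteq> G \<Longrightarrow> set b \<subseteq> G \<Longrightarrow> word (a @ u @ b) \<in> J"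
  using ideal_word_mult[of "word u" a b] by (simp add: word_times_word)

lemma word_cong_context:
  "word u - word v \<in> J \<Longrightarrow> set a \<subseteq> G \<Longrightarrow> set b \<subseteq> G \<Longrightarrow>
    word (a @ u @ b) - word (a @ v @ b) \<in> J"
  using ideal_word_mult[of "word u - word v" a b]
  by (simp add: word_times_word left_diff_distrib right_diff_distrib)

lemma word_null_cong: "word u - word v \<in> J \<Longrightarrow> word v \<in> J \<Longrightarrow> word u \<in> J"
  using ideal_add[of "word u - word v" "word v"] by simp

section \<open>Cosets and the quotient algebra\<close>

abbreviation coset :: "('g list \<Rightarrow>\<^sub>0 'k) \<Rightarrow> ('g list \<Rightarrow>\<^sub>0 'k) set" where
  "coset x \<equiv> J +>\<^bsub>free_algebra G\<^esub> x"

lemma mem_coset: "y \<in> coset x \<longleftrightarrow> y - x \<in> J"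
proof
  assume "y - x \<in> J"
  then show "y \<in> coset x"
    by (auto simp: a_r_coset_def' intro!: bexI[of _ "y - x"])
qed (auto simp: a_r_coset_def')

lemma coset_eq_iff: "coset x = coset y \<longleftrightarrow> x - y \<in> J"
proof
  assume "coset x = coset y"
  moreover have "x \<in> coset x"
    by (simp add: mem_coset ideal_zero)
  ultimately show "x - y \<in> J"
    by (simp add: mem_coset)
next
  assume *: "x - y \<in> J"
  then show "coset x = coset y"
    using ideal_diff_trans[of _ x y] ideal_diff_trans[of _ y x] ideal_diff_sym[OF *]
    by (auto simp: mem_coset)
qed

lemma coset_self: "x \<in> coset x"
  by (simp add: mem_coset ideal_zero)

lemma coset_add: "set_add (free_algebra G) (coset x) (coset y) = coset (x + y)"
proof (intro Set.set_eqI iffI)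
  fix z assume "z \<in> set_add (free_algebra G) (coset x) (coset y)"
  then obtain a b where "z = a + b" "a - x \<in> J" "b - y \<in> J"
    by (auto simp: set_add_def' mem_coset)
  then show "z \<in> coset (x + y)"
    using ideal_add[of "a - x" "b - y"] by (simp add: mem_coset algebra_simps)
next
  fix z assume "z \<in> coset (x + y)"
  then have "z - y \<in> coset x" "z = (z - y) + y"
    by (simp_all add: mem_coset algebra_simps)
  then show "z \<in> set_add (free_algebra G) (coset x) (coset y)"
    using coset_self[of y] unfolding set_add_def' free_algebra_simps by blast
qed

lemma carrier_coset:
  assumes "x \<in> carrier (free_algebra G)" "y \<in> coset x"
  shows "y \<in> carrier (free_algebra G)"
proof -
  have "y - x \<in> carrier (free_algebra G)"
    using assms ideal_subset by (auto simp: mem_coset)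
  from free_algebra_add[OF this assms(1)] show ?thesis
    by simp
qed

text \<open>Uses a b - x y = (a - x) b + x (b - y). The ideal absorbs only elements of the free
  algebra, which is why \<open>carrier_coset\<close> enters.\<close>

lemma coset_mult:
  assumes x: "x \<in> carrier (free_algebra G)" and y: "y \<in> carrier (free_algebra G)"
  shows "rcoset_mult (free_algebra G) J (coset x) (coset y) = coset (x * y)"
proof -
  have "coset (a * b) = coset (x * y)" if a: "a \<in> coset x" and b: "b \<in> coset y" for a b
  proof -
    have "(a - x) * b + x * (b - y) \<in> J"
      using a b x carrier_coset[OF y b] by (intro ideal_add ideal_lmult ideal_rmult) (simp_all add: mem_coset)
    then show ?thesis
      by (simp add: coset_eq_iff algebra_simps)
  qed
  then show ?thesis
    unfolding rcoset_mult_def free_algebra_simps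
    by (intro UN_constant_eq[OF coset_self] ballI) blast
qed

text \<open>The scalar multiple in \<open>quotient_algebra\<close> is a union over all
  representatives; each of them gives the same coset.\<close>

lemma coset_scale: "(\<Union>z\<in>coset x. coset (Poly_Mapping.single 0 c * z)) = coset (Poly_Mapping.single 0 c * x)"
proof -
  have "coset (Poly_Mapping.single 0 c * z) = coset (Poly_Mapping.single 0 c * x)" if "z \<in> coset x" for z
    using that ideal_scale[of "z - x" c] by (simp add: coset_eq_iff mem_coset right_diff_distrib)
  then show ?thesis
    by (intro UN_constant_eq[OF coset_self] ballI)
qed

abbreviation quotient :: "('k, ('g list \<Rightarrow>\<^sub>0 'k) set) module" where
  "quotient \<equiv> quotient_algebra (free_algebra G) J"

lemma carrier_quotient: "carrier quotient = coset ` carrier (free_algebra G)"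
  by (auto simp: quotient_algebra_def A_RCOSETS_def')

lemma quotient_add: "coset x \<oplus>\<^bsub>quotient\<^esub> coset y = coset (x + y)"
  by (simp add: quotient_algebra_def coset_add)

lemma quotient_mult:
  "x \<in> carrier (free_algebra G) \<Longrightarrow> y \<in> carrier (free_algebra G) \<Longrightarrow>
    coset x \<otimes>\<^bsub>quotient\<^esub> coset y = coset (x * y)"
  by (simp add: quotient_algebra_def coset_mult)

lemma quotient_scale: "c \<odot>\<^bsub>quotient\<^esub> coset x = coset (Poly_Mapping.single 0 c * x)"
  by (simp add: quotient_algebra_def coset_scale)

lemma quotient_zero: "\<zero>\<^bsub>quotient\<^esub> = coset 0"
  by (auto simp: quotient_algebra_def mem_coset)

text \<open>Provides the structure for \<open>finsum\<close>, which occurs in the product of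
  \<open>matrix_algebra\<close>.\<close>

lemma abelian_monoid_quotient: "abelian_monoid quotient"
proof (rule abelian_monoidI)
qed (auto simp: carrier_quotient quotient_add quotient_zero add_ac intro: free_algebra_add free_algebra_zero)

lemma quotient_finsum:
  assumes "finite A" "\<And>l. l \<in> A \<Longrightarrow> f l \<in> carrier (free_algebra G)"
  shows "(\<Oplus>\<^bsub>quotient\<^esub>l\<in>A. coset (f l)) = coset (\<Sum>l\<in>A. f l)"
  using assms
proof (induction A rule: finite_induct)
  case empty
  then show ?case
    by (simp add: abelian_monoid.finsum_empty[OF abelian_monoid_quotient] quotient_zero)
next
  case (insert a A)
  then show ?case
    by (subst abelian_monoid.finsum_insert[OF abelian_monoid_quotient])
      (auto simp: carrier_quotient quotient_add)
qed

end

section \<open>Words in a weighted Leavitt path algebra\<close>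

definition wlpa_ideal :: "('v, 'e) pre_digraph \<Rightarrow> ('e \<Rightarrow> nat) \<Rightarrow> ('k::field, 'v, 'e) gen_poly set" where
  "wlpa_ideal E w = generated_algebra_ideal (free_algebra (gens E w)) (wlpa_relations E w)"

text \<open>A ghost edge runs against its edge and a vertex is a loop at itself, so the generators
  are the edges of a doubled graph with loops.\<close>

fun gen_src :: "('v, 'e) pre_digraph \<Rightarrow> ('v, 'e) gen \<Rightarrow> 'v" where
  "gen_src E (Vertex v) = v"
| "gen_src E (Edge e i) = tail E e"
| "gen_src E (Ghost e i) = head E e"

fun gen_rng :: "('v, 'e) pre_digraph \<Rightarrow> ('v, 'e) gen \<Rightarrow> 'v" where
  "gen_rng E (Vertex v) = v"
| "gen_rng E (Edge e i) = head E e"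
| "gen_rng E (Ghost e i) = tail E e"

text \<open>The end maps are parameters because the notion is applied to vertices of
  \<open>E\<close>, to vertices of the extended graph and to each of their two coordinates.\<close>

primrec walk :: "('g \<Rightarrow> 'p) \<Rightarrow> ('g \<Rightarrow> 'p) \<Rightarrow> 'p \<Rightarrow> 'g list \<Rightarrow> 'p \<Rightarrow> bool" where
  "walk s r x [] y \<longleftrightarrow> x = y"
| "walk s r x (g # u) y \<longleftrightarrow> x = s g \<and> walk s r (r g) u y"

lemma walk_append: "walk s r x (u @ v) z \<longleftrightarrow> (\<exists>y. walk s r x u y \<and> walk s r y v z)"
  by (induction u arbitrary: x) auto

lemma walk_ends: "walk s r x u y \<Longrightarrow> u \<noteq> [] \<Longrightarrow> x = s (hd u) \<and> y = r (last u)"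
  by (induction u arbitrary: x) (auto split: if_splits)

lemma walk_map: "walk s r x u y \<Longrightarrow> walk (\<lambda>g. f (s g)) (\<lambda>g. f (r g)) (f x) u (f y)"
  by (induction u arbitrary: x) auto

lemma walk_map_list: "walk s r x (map f u) y \<longleftrightarrow> walk (\<lambda>g. s (f g)) (\<lambda>g. r (f g)) x u y"
  by (induction u arbitrary: x) auto

text \<open>Conversely to \<open>walk_map\<close>, walks in the two coordinates along the same word
  fit together.\<close>

lemma walk_Pair:
  "walk (\<lambda>g. fst (s g)) (\<lambda>g. fst (r g)) (fst x) u (fst y) \<Longrightarrow>
    walk (\<lambda>g. snd (s g)) (\<lambda>g. snd (r g)) (snd x) u (snd y) \<Longrightarrow> walk s r x u y"
  by (induction u arbitrary: x) (auto simp: prod_eq_iff)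

text \<open>Makes \<open>algebra_ideal_generated\<close> applicable. In the sums, a subscript above
  the weight of an edge gives the zero polynomial; subscripts start at 1 since
  \<open>Edge e 0\<close> and \<open>Ghost e 0\<close> are no generators.\<close>

lemma wlpa_relations_subset:
  fixes E :: "('v, 'e) pre_digraph"
  assumes "row_finite_weighted_graph E w"
  shows "(wlpa_relations E w :: ('k::field, 'v, 'e) gen_poly set) \<subseteq> carrier (free_algebra (gens E w))"
proof
  interpret row_finite_weighted_graph E w by fact
  note intros = free_algebra_zero free_algebra_diff free_algebra_sum free_algebra_single free_algebra_mult
  have vertex: "vertex_poly v \<in> carrier (free_algebra (gens E w))" if "v \<in> verts E" for v
    using that unfolding vertex_poly_def by (intro free_algebra_single) (auto simp: gens_def)
  have edge: "edge_poly w e i \<in> carrier (free_algebra (gens E w))" if "e \<in> arcs E" "1 \<le> i" for e i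
    using that unfolding edge_poly_def by (auto simp: gens_def intro!: intros)
  have ghost: "ghost_poly w e i \<in> carrier (free_algebra (gens E w))" if "e \<in> arcs E" "1 \<le> i" for e i
    using that unfolding ghost_poly_def by (auto simp: gens_def intro!: intros)
  fix r :: "('k, 'v, 'e) gen_poly"
  assume "r \<in> wlpa_relations E w"
  then show "r \<in> carrier (free_algebra (gens E w))"
  proof induction
    case (vertices u v)
    then show ?case
      by (simp add: free_algebra_zero free_algebra_diff free_algebra_mult vertex)
  next
    case (edge_ghost v i j)
    then have "(if i = j then vertex_poly v else 0) \<in> carrier (free_algebra (gens E w))"
      by (simp add: regular_verts_def vertex free_algebra_zero)
    with edge_ghost show ?case
      by (intro free_algebra_diff free_algebra_sum free_algebra_mult edge ghost) simp_all
  next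
    case (ghost_edge v e f)
    then have "(if e = f then vertex_poly (head E e) else 0) \<in> carrier (free_algebra (gens E w))"
      by (simp add: vertex free_algebra_zero)
    with ghost_edge show ?case
      by (intro free_algebra_diff free_algebra_sum free_algebra_mult edge ghost) simp_all
  qed (simp_all add: free_algebra_diff free_algebra_mult vertex edge ghost)
qed

text \<open>The parameter \<open>K\<close> fixes the type of the coefficients, which neither
  \<open>E\<close> nor \<open>w\<close> mentions.\<close>

locale weighted_leavitt = row_finite_weighted_graph E w
  for E :: "('v, 'e) pre_digraph" and w :: "'e \<Rightarrow> nat" +
  fixes K :: "'k::field itself"
begin

abbreviation I :: "('k, 'v, 'e) gen_poly set" where
  "I \<equiv> wlpa_ideal E w"

sublocale free_algebra_ideal "gens E w" I
  unfolding wlpa_ideal_def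
  by (rule free_algebra_ideal.intro[OF algebra_ideal_generated[OF wlpa_relations_subset]])
    (rule row_finite_weighted_graph_axioms)

lemma relations_subset_ideal: "r \<in> wlpa_relations E w \<Longrightarrow> r \<in> I"
  unfolding wlpa_ideal_def by (rule subsetD[OF generated_algebra_ideal_incl])

lemma gens_cases [consumes 1, case_names Vertex Edge Ghost]:
  assumes "g \<in> gens E w"
  obtains v where "g = Vertex v" "v \<in> verts E"
  | e i where "g = Edge e i" "e \<in> arcs E" "1 \<le> i" "i \<le> w e"
  | e i where "g = Ghost e i" "e \<in> arcs E" "1 \<le> i" "i \<le> w e"
  using assms by (auto simp: gens_def)

lemma gen_src_in_verts: "g \<in> gens E w \<Longrightarrow> gen_src E g \<in> verts E"
  by (cases rule: gens_cases) auto

lemma gen_rng_in_verts: "g \<in> gens E w \<Longrightarrow> gen_rng E g \<in> verts E"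
  by (cases rule: gens_cases) auto

lemma hd_in_gens: "u \<in> words (gens E w) \<Longrightarrow> hd u \<in> gens E w"
  using hd_in_set[of u] by blast

lemma last_in_gens: "u \<in> words (gens E w) \<Longrightarrow> last u \<in> gens E w"
  using last_in_set[of u] by blast

lemma Vertex_in_gens: "v \<in> verts E \<Longrightarrow> Vertex v \<in> gens E w"
  by (auto simp: gens_def)

section \<open>Products of generators modulo the relations\<close>

lemma Vertex_Vertex: "v \<in> verts E \<Longrightarrow> word [Vertex v, Vertex v] - word [Vertex v] \<in> I"
  using relations_subset_ideal[OF wlpa_relations.vertices[of v _ v]]
  by (simp add: vertex_poly_def word_times_word)

lemma gen_src_gen:
  assumes "g \<in> gens E w"
  shows "word [Vertex (gen_src E g), g] - word [g] \<in> I"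
  using assms
proof (cases rule: gens_cases)
  case (Edge e i)
  then show ?thesis
    using relations_subset_ideal[OF wlpa_relations.tail_edge[of e _ i]]
    by (simp add: vertex_poly_def edge_poly_def word_times_word)
next
  case (Ghost e i)
  then show ?thesis
    using relations_subset_ideal[OF wlpa_relations.head_ghost[of e _ i]]
    by (simp add: vertex_poly_def ghost_poly_def word_times_word)
qed (simp add: Vertex_Vertex)

lemma gen_gen_rng:
  assumes "g \<in> gens E w"
  shows "word [g, Vertex (gen_rng E g)] - word [g] \<in> I"
  using assms
proof (cases rule: gens_cases)
  case (Edge e i)
  then show ?thesis
    using relations_subset_ideal[OF wlpa_relations.edge_head[of e _ i]]
    by (simp add: vertex_poly_def edge_poly_def word_times_word)
next
  case (Ghost e i)
  then show ?thesis
    using relations_subset_ideal[OF wlpa_relations.ghost_tail[of e _ i]]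
    by (simp add: vertex_poly_def ghost_poly_def word_times_word)
qed (simp add: Vertex_Vertex)

text \<open>Insert the range of \<open>g\<close> and the source of \<open>h\<close>: g h is
  congruent to g r(g) s(h) h, and the two distinct vertices in the middle are orthogonal.\<close>

lemma mismatch_null:
  assumes g: "g \<in> gens E w" and h: "h \<in> gens E w" and neq: "gen_rng E g \<noteq> gen_src E h"
  shows "word [g, h] \<in> I"
proof -
  let ?r = "Vertex (gen_rng E g)" and ?s = "Vertex (gen_src E h)"
  have mem: "?r \<in> gens E w" "?s \<in> gens E w"
    using g h by (simp_all add: Vertex_in_gens gen_src_in_verts gen_rng_in_verts)
  have "word [?r, ?s] \<in> I"
    using relations_subset_ideal[OF wlpa_relations.vertices, of "gen_rng E g" "gen_src E h"] g h neq
    by (simp add: vertex_poly_def word_times_word gen_src_in_verts gen_rng_in_verts)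
  from word_null_context[OF this, of "[g]" "[h]"] have "word [g, ?r, ?s, h] \<in> I"
    using g h by simp
  moreover have "word [g, ?s, h] - word [g, ?r, ?s, h] \<in> I"
    using ideal_diff_sym[OF word_cong_context[OF gen_gen_rng[OF g], of "[]" "[?s, h]"]] mem g h
    by simp
  moreover have "word [g, h] - word [g, ?s, h] \<in> I"
    using ideal_diff_sym[OF word_cong_context[OF gen_src_gen[OF h], of "[g]" "[]"]] g
    by simp
  ultimately show ?thesis
    using word_null_cong by blast
qed

abbreviation vertex_walk :: "'v \<Rightarrow> ('v, 'e) gen list \<Rightarrow> 'v \<Rightarrow> bool" where
  "vertex_walk \<equiv> walk (gen_src E) (gen_rng E)"

text \<open>If the first two generators do not match, their product is null; if they match, the tail
  cannot be a walk either and induction applies.\<close>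

lemma not_walk_null:
  assumes "u \<in> words (gens E w)" "\<And>x y. \<not> vertex_walk x u y"
  shows "word u \<in> I"
proof -
  have "u \<noteq> []"
    using assms by simp
  then show ?thesis
    using assms
  proof (induction u rule: list_nonempty_induct)
    case (single g)
    from single.prems(2)[of "gen_src E g" "gen_rng E g"] show ?case
      by simp
  next
    case (cons g u)
    show ?case
    proof (cases "gen_rng E g = gen_src E (hd u)")
      case True
      have "word u \<in> I"
      proof (rule cons.IH)
        fix x y show "\<not> vertex_walk x u y"
          using cons.prems(2)[of "gen_src E g" y] cons.hyps True walk_ends[of _ _ x u y] by auto
      qed (use cons in auto)
      from word_null_context[OF this, of "[g]" "[]"] show ?thesis
        using cons.prems by simp
    next
      case False
      obtain h v where u: "u = h # v"
        using cons.hyps by (cases u) auto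
      have "word [g, h] \<in> I"
        using False cons.prems by (intro mismatch_null) (auto simp: u)
      from word_null_context[OF this, of "[]" v] show ?thesis
        using cons.prems by (simp add: u)
    qed
  qed
qed

lemma word_src:
  assumes "u \<in> words (gens E w)"
  shows "word (Vertex (gen_src E (hd u)) # u) - word u \<in> I"
proof -
  obtain g v where u: "u = g # v"
    using assms by (cases u) auto
  show ?thesis
    using word_cong_context[OF gen_src_gen, of g "[]" v] assms by (simp add: u)
qed

lemma word_rng:
  assumes "u \<in> words (gens E w)"
  shows "word (u @ [Vertex (gen_rng E (last u))]) - word u \<in> I"
proof -
  obtain v g where u: "u = v @ [g]"
    using assms by (cases u rule: rev_cases) auto
  show ?thesis
    using word_cong_context[OF gen_gen_rng, of g v "[]"] assms by (simp add: u)
qed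

end

section \<open>Attaching heads\<close>

text \<open>The path from v_i down to v; \<open>head_copath\<close> is its star, from v up to v_i.
  The edge labelled \<open>Suc i\<close> leads from index \<open>Suc i\<close> to \<open>i\<close>,
  and having weight 1 it has the single subscript 1.\<close>

primrec head_path :: "'v \<Rightarrow> nat \<Rightarrow> ('v \<times> nat, 'e + 'v \<times> nat) gen list" where
  "head_path v 0 = []"
| "head_path v (Suc i) = Edge (Inr (v, Suc i)) 1 # head_path v i"

primrec head_copath :: "'v \<Rightarrow> nat \<Rightarrow> ('v \<times> nat, 'e + 'v \<times> nat) gen list" where
  "head_copath v 0 = []"
| "head_copath v (Suc i) = head_copath v i @ [Ghost (Inr (v, Suc i)) 1]"

abbreviation lift_gen :: "('v, 'e) gen \<Rightarrow> ('v \<times> nat, 'e + 'v \<times> nat) gen" where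
  "lift_gen \<equiv> map_gen (\<lambda>v. (v, 0)) Inl"

fun base_gen :: "('v \<times> nat, 'e + 'v \<times> nat) gen \<Rightarrow> ('v, 'e) gen" where
  "base_gen (Vertex p) = Vertex (fst p)"
| "base_gen (Edge (Inl e) i) = Edge e i"
| "base_gen (Edge (Inr p) i) = Vertex (fst p)"
| "base_gen (Ghost (Inl e) i) = Ghost e i"
| "base_gen (Ghost (Inr p) i) = Vertex (fst p)"

section \<open>Arcs, weights and ends in the extended graph\<close>

lemma head_graph_simps [simp]:
  "verts (head_graph n E) = verts E \<times> {0..<n}"
  "arcs (head_graph n E) = Inl ` arcs E \<union> Inr ` (verts E \<times> {1..<n})"
  "tail (head_graph n E) (Inl e) = (tail E e, 0)"
  "tail (head_graph n E) (Inr p) = p"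
  "head (head_graph n E) (Inl e) = (head E e, 0)"
  "head (head_graph n E) (Inr p) = (fst p, snd p - 1)"
  by (auto simp: head_graph_def split: prod.splits)

lemma head_weight_simps [simp]: "head_weight w (Inl e) = w e" "head_weight w (Inr p) = 1"
  by (simp_all add: head_weight_def)

text \<open>New edges start at index 1 or higher, so v_0 emits precisely the old edges of v. Each
  sum over outgoing edges in the relations is thus an old sum or has a single term.\<close>

lemma out_arcs_head_graph:
  "out_arcs (head_graph n E) (v, i) =
    (if i = 0 then Inl ` out_arcs E v else if v \<in> verts E \<and> i < n then {Inr (v, i)} else {})"
  by (auto simp: out_arcs_def)

lemma row_finite_head_graph:
  assumes "row_finite_weighted_graph E w" "1 \<le> n"
  shows "row_finite_weighted_graph (head_graph n E) (head_weight w)"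
proof -
  interpret row_finite_weighted_graph E w by fact
  show ?thesis
  proof
    fix a assume a: "a \<in> arcs (head_graph n E)"
    then show "tail (head_graph n E) a \<in> verts (head_graph n E)"
      using \<open>1 \<le> n\<close> by auto
    from a show "head (head_graph n E) a \<in> verts (head_graph n E)"
      using \<open>1 \<le> n\<close> by auto
    from a show "1 \<le> head_weight w a"
      using weight_pos by auto
  next
    fix p assume "p \<in> verts (head_graph n E)"
    then show "finite (out_arcs (head_graph n E) p)"
      using row_finite by (cases p) (auto simp: out_arcs_head_graph)
  qed
qed

lemma regular_verts_head_graph:
  "1 \<le> n \<Longrightarrow> (v, 0) \<in> regular_verts (head_graph n E) \<longleftrightarrow> v \<in> regular_verts E"
  by (auto simp: regular_verts_def out_arcs_head_graph finite_image_iff)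

lemma vertex_weight_head_graph:
  "vertex_weight (head_graph n E) (head_weight w) (v, 0) = vertex_weight E w v"
  "v \<in> verts E \<Longrightarrow> i \<noteq> 0 \<Longrightarrow> i < n \<Longrightarrow> vertex_weight (head_graph n E) (head_weight w) (v, i) = 1"
  by (simp_all add: vertex_weight_def out_arcs_head_graph image_image)

text \<open>Collapsing the heads commutes with taking ends once the index is forgotten; words that
  walk in the extended graph therefore collapse to walks in \<open>E\<close>.\<close>

lemma fst_gen_src: "fst (gen_src (head_graph n E) g) = gen_src E (base_gen g)"
  by (cases g rule: base_gen.cases) auto

lemma fst_gen_rng: "fst (gen_rng (head_graph n E) g) = gen_rng E (base_gen g)"
  by (cases g rule: base_gen.cases) auto

lemma gen_src_lift: "gen_src (head_graph n E) (lift_gen g) = (gen_src E g, 0)"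
  by (cases g) auto

lemma gen_rng_lift: "gen_rng (head_graph n E) (lift_gen g) = (gen_rng E g, 0)"
  by (cases g) auto

lemma base_lift: "base_gen (lift_gen g) = g"
  by (cases g) auto

locale weighted_leavitt_heads = weighted_leavitt E w K
  for E :: "('v, 'e) pre_digraph" and w :: "'e \<Rightarrow> nat" and K :: "'k::field itself" +
  fixes n :: nat
  assumes n_pos: "1 \<le> n"
begin

abbreviation "E' \<equiv> head_graph n E"
abbreviation "w' \<equiv> head_weight w"

text \<open>Facts without prefix concern \<open>E\<close> and \<open>I\<close>, those with prefix
  \<open>heads\<close> the extended graph and \<open>I'\<close>.\<close>

sublocale heads: weighted_leavitt E' w' K
  by (rule weighted_leavitt.intro[OF row_finite_head_graph[OF row_finite_weighted_graph_axioms n_pos]])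

abbreviation "I' \<equiv> heads.I"

abbreviation "C \<equiv> carrier (free_algebra (gens E w) :: ('k, ('k, 'v, 'e) gen_poly) module)"
abbreviation "C' \<equiv> carrier (free_algebra (gens E' w') ::
  ('k, ('k, 'v \<times> nat, 'e + 'v \<times> nat) gen_poly) module)"

text \<open>New edges have weight 1, hence subscript 1. Writing their index as \<open>Suc i\<close>
  fits the recursion of \<open>head_path\<close> and \<open>head_copath\<close>.\<close>

lemma heads_gens_cases [consumes 1, case_names Vertex Edge_old Edge_new Ghost_old Ghost_new]:
  assumes "g \<in> gens E' w'"
  obtains v i where "g = Vertex (v, i)" "v \<in> verts E" "i < n"
  | e i where "g = Edge (Inl e) i" "Edge e i \<in> gens E w"
  | v i where "g = Edge (Inr (v, Suc i)) 1" "v \<in> verts E" "Suc i < n"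
  | e i where "g = Ghost (Inl e) i" "Ghost e i \<in> gens E w"
  | v i where "g = Ghost (Inr (v, Suc i)) 1" "v \<in> verts E" "Suc i < n"
  using assms
proof (cases rule: heads.gens_cases)
  case (Vertex p)
  then show ?thesis
    using that(1) by auto
next
  case (Edge a k)
  show ?thesis
  proof (cases a)
    case (Inl e)
    then show ?thesis
      using Edge that(2) by (auto simp: gens_def)
  next
    case (Inr p)
    then show ?thesis
      using Edge that(3)[of "fst p" "snd p - 1"] by auto
  qed
next
  case (Ghost a k)
  show ?thesis
  proof (cases a)
    case (Inl e)
    then show ?thesis
      using Ghost that(4) by (auto simp: gens_def)
  next
    case (Inr p)
    then show ?thesis
      using Ghost that(5)[of "fst p" "snd p - 1"] by auto
  qed
qed

lemma base_in_gens: "g \<in> gens E' w' \<Longrightarrow> base_gen g \<in> gens E w"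
  by (erule heads_gens_cases) (auto simp: Vertex_in_gens)

lemma lift_in_gens: "g \<in> gens E w \<Longrightarrow> lift_gen g \<in> gens E' w'"
  using n_pos by (auto simp: gens_def)

lemma map_base_in_words: "u \<in> words (gens E' w') \<Longrightarrow> map base_gen u \<in> words (gens E w)"
  using base_in_gens by auto

lemma map_lift_in_words: "u \<in> words (gens E w) \<Longrightarrow> map lift_gen u \<in> words (gens E' w')"
  using lift_in_gens by auto

text \<open>Only the positions in the heads are followed. If these match but the base vertices do
  not, the collapsed word is null modulo \<open>I\<close> anyway.\<close>

abbreviation index_walk :: "nat \<Rightarrow> ('v \<times> nat, 'e + 'v \<times> nat) gen list \<Rightarrow> nat \<Rightarrow> bool" where
  "index_walk \<equiv> walk (\<lambda>g. snd (gen_src E' g)) (\<lambda>g. snd (gen_rng E' g))"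

subsection \<open>The homomorphism to matrices\<close>

text \<open>A generator gives a matrix unit from its source index to its range index, with the
  collapsed generator as coefficient. A product of such matrices is nonzero only along an index
  walk.\<close>

definition entry :: "nat \<Rightarrow> nat \<Rightarrow> ('k, 'v \<times> nat, 'e + 'v \<times> nat) gen_poly \<Rightarrow> ('k, 'v, 'e) gen_poly" where
  "entry i j = linear_extension (\<lambda>u. if index_walk i u j then word (map base_gen u) else 0)"

lemma entry_single:
  "entry i j (Poly_Mapping.single u c) =
    (if index_walk i u j then Poly_Mapping.single (map base_gen u) c else 0)"
  by (simp add: entry_def scale_word)

lemma entry_zero: "entry i j 0 = 0"
  by (simp add: entry_def)

lemma entry_add: "entry i j (p + q) = entry i j p + entry i j q"
  by (simp add: entry_def linear_extension_add)

lemma entry_diff: "entry i j (p - q) = entry i j p - entry i j q"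
  by (simp add: entry_def linear_extension_diff)

lemma entry_sum: "entry i j (\<Sum>x\<in>A. f x) = (\<Sum>x\<in>A. entry i j (f x))"
  by (simp add: entry_def linear_extension_sum)

lemma entry_scale: "entry i j (Poly_Mapping.single 0 c * p) = Poly_Mapping.single 0 c * entry i j p"
  by (simp add: entry_def linear_extension_scale)

lemma entry_closed: "p \<in> C' \<Longrightarrow> entry i j p \<in> C"
  unfolding entry_def
  by (erule linear_extension_closed) (auto intro!: free_algebra_zero free_algebra_single base_in_gens)

lemma entry_mult_single:
  assumes v: "v \<in> words (gens E' w')"
  shows "entry i j (Poly_Mapping.single u c * Poly_Mapping.single v d) =
    (\<Sum>k<n. entry i k (Poly_Mapping.single u c) * entry k j (Poly_Mapping.single v d))"
proof -
  \<comment> \<open>The only middle index that can contribute is the one where the nonempty word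
    \<open>v\<close> starts.\<close>
  let ?k = "snd (gen_src E' (hd v))"
  have "gen_src E' (hd v) \<in> verts E'"
    using v heads.gen_src_in_verts[of "hd v"] hd_in_set[of v] by blast
  then have k: "?k < n"
    by auto
  have unique: "k = ?k" if "index_walk k v j" for k
    using walk_ends[OF that] v by simp
  have sum: "(\<Sum>k<n. entry i k (Poly_Mapping.single u c) * entry k j (Poly_Mapping.single v d)) =
      (\<Sum>k\<in>{?k}. entry i k (Poly_Mapping.single u c) * entry k j (Poly_Mapping.single v d))"
    by (rule sum.mono_neutral_right) (use k unique in \<open>auto simp: entry_single\<close>)
  have "index_walk i (u @ v) j \<longleftrightarrow> index_walk i u ?k \<and> index_walk ?k v j"
    unfolding walk_append by (blast dest: unique)
  then have "(\<Sum>k\<in>{?k}. entry i k (Poly_Mapping.single u c) * entry k j (Poly_Mapping.single v d)) =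
      entry i j (Poly_Mapping.single (u @ v) (c * d))"
    by (simp add: entry_single mult_single plus_list_def)
  then show ?thesis
    unfolding sum by (simp add: mult_single plus_list_def)
qed

text \<open>By bilinearity this reduces to words; multiplicativity holds exactly in the free
  algebra, before any relation is used.\<close>

lemma entry_mult:
  assumes "p \<in> C'" "q \<in> C'"
  shows "entry i j (p * q) = (\<Sum>k<n. entry i k p * entry k j q)"
  using assms(2)
proof (induction q rule: free_algebra_induct)
  case (single v d)
  from assms(1) show ?case
  proof (induction p rule: free_algebra_induct)
    case (single u c)
    show ?case
      by (rule entry_mult_single) fact
  qed (simp_all add: entry_zero entry_add distrib_right sum.distrib)
qed (simp_all add: entry_zero entry_add distrib_left sum.distrib)

text \<open>The vertex put in front has the source index of \<open>g\<close> at both ends, so both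
  words are index walks for the same \<open>i\<close> and \<open>j\<close>.\<close>

lemma entry_gen_src_gen:
  assumes "g \<in> gens E' w'"
  shows "entry i j (word [Vertex (gen_src E' g), g] - word [g]) \<in> I"
  using gen_src_gen[OF base_in_gens[OF assms]]
  by (simp add: entry_diff entry_single fst_gen_src ideal_zero)

lemma entry_gen_gen_rng:
  assumes "g \<in> gens E' w'"
  shows "entry i j (word [g, Vertex (gen_rng E' g)] - word [g]) \<in> I"
  using gen_gen_rng[OF base_in_gens[OF assms]]
  by (simp add: entry_diff entry_single fst_gen_rng ideal_zero)

text \<open>The sum relations at v_0 become those of \<open>E\<close> in position (0, 0). At v_m
  with m > 0 the sums have one term, and the entry that remains is v v - v.\<close>

lemma entry_relation:
  assumes "r \<in> wlpa_relations E' w'"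
  shows "entry i j r \<in> I"
  using assms
proof cases
  case (vertices p q)
  obtain u k v l where pq: "p = (u, k)" "q = (v, l)"
    by (cases p, cases q) auto
  have "vertex_poly u * vertex_poly v - (if u = v then vertex_poly u else 0) \<in> I"
    using vertices by (intro relations_subset_ideal wlpa_relations.vertices) (auto simp: pq)
  \<comment> \<open>For \<open>k \<noteq> l\<close> the product is not an index walk and the two
    vertices differ, so every entry vanishes.\<close>
  moreover have "entry i j r =
      (if i = k \<and> j = k \<and> l = k
       then vertex_poly u * vertex_poly v - (if u = v then vertex_poly u else 0) else 0)"
    by (auto simp: vertices(1) pq vertex_poly_def word_times_word entry_diff entry_single entry_zero)
  ultimately show ?thesis
    by (simp add: ideal_zero)
next
  case (tail_edge a k)
  then show ?thesis
    using entry_gen_src_gen[of "Edge a k"]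
    by (simp add: gens_def vertex_poly_def edge_poly_def word_times_word)
next
  case (edge_head a k)
  then show ?thesis
    using entry_gen_gen_rng[of "Edge a k"]
    by (simp add: gens_def vertex_poly_def edge_poly_def word_times_word)
next
  case (head_ghost a k)
  then show ?thesis
    using entry_gen_src_gen[of "Ghost a k"]
    by (simp add: gens_def vertex_poly_def ghost_poly_def word_times_word)
next
  case (ghost_tail a k)
  then show ?thesis
    using entry_gen_gen_rng[of "Ghost a k"]
    by (simp add: gens_def vertex_poly_def ghost_poly_def word_times_word)
next
  case (edge_ghost p k l)
  obtain v m where p: "p = (v, m)"
    by (cases p)
  show ?thesis
  proof (cases "m = 0")
    case True
    have reg: "v \<in> regular_verts E" and weight: "vertex_weight E' w' p = vertex_weight E w v"
      using edge_ghost(2) n_pos by (simp_all add: p True regular_verts_head_graph vertex_weight_head_graph)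
    have rel: "(\<Sum>e\<in>out_arcs E v. edge_poly w e k * ghost_poly w e l) - (if k = l then vertex_poly v else 0) \<in> I"
      using edge_ghost reg weight by (intro relations_subset_ideal wlpa_relations.edge_ghost) auto
    have "entry i j (edge_poly w' (Inl e) k * ghost_poly w' (Inl e) l) =
        (if i = 0 \<and> j = 0 then edge_poly w e k * ghost_poly w e l else 0)" for e
      by (auto simp: edge_poly_def ghost_poly_def word_times_word entry_single entry_zero)
    then have "entry i j r =
        (if i = 0 \<and> j = 0
         then (\<Sum>e\<in>out_arcs E v. edge_poly w e k * ghost_poly w e l) - (if k = l then vertex_poly v else 0)
         else 0)"
      by (auto simp: edge_ghost(1) p True out_arcs_head_graph sum.reindex entry_diff entry_sum
          entry_single entry_zero vertex_poly_def)
    then show ?thesis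
      using rel by (simp add: ideal_zero)
  next
    case False
    have v: "v \<in> verts E" "m < n"
      using edge_ghost(2) by (auto simp: p regular_verts_def)
    then have "k = 1" "l = 1"
      using edge_ghost False by (simp_all add: p vertex_weight_head_graph)
    then have "entry i j r =
        (if i = m \<and> j = m then word [Vertex v, Vertex v] - word [Vertex v] else 0)"
      using v False
      by (simp add: edge_ghost(1) p out_arcs_head_graph edge_poly_def ghost_poly_def vertex_poly_def
          word_times_word entry_diff entry_single)
    then show ?thesis
      using Vertex_Vertex[OF v(1)] by (simp add: ideal_zero)
  qed
next
  case (ghost_edge p a b)
  obtain v m where p: "p = (v, m)"
    by (cases p)
  show ?thesis
  proof (cases "m = 0")
    case True
    obtain e f where ef: "a = Inl e" "b = Inl f" "e \<in> out_arcs E v" "f \<in> out_arcs E v"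
      using ghost_edge by (auto simp: p True out_arcs_head_graph)
    have reg: "v \<in> regular_verts E" and weight: "vertex_weight E' w' p = vertex_weight E w v"
      using ghost_edge(2) n_pos by (simp_all add: p True regular_verts_head_graph vertex_weight_head_graph)
    have rel: "(\<Sum>k\<in>{1..vertex_weight E w v}. ghost_poly w e k * edge_poly w f k)
        - (if e = f then vertex_poly (head E e) else 0) \<in> I"
      using reg ef by (intro relations_subset_ideal wlpa_relations.ghost_edge) auto
    have "entry i j (ghost_poly w' (Inl e) k * edge_poly w' (Inl f) k) =
        (if i = 0 \<and> j = 0 then ghost_poly w e k * edge_poly w f k else 0)" for k
      using ef by (auto simp: edge_poly_def ghost_poly_def word_times_word entry_single entry_zero)
    then have "entry i j r =
        (if i = 0 \<and> j = 0
         then (\<Sum>k\<in>{1..vertex_weight E w v}. ghost_poly w e k * edge_poly w f k)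
           - (if e = f then vertex_poly (head E e) else 0)
         else 0)"
      by (auto simp: ghost_edge(1) ef weight entry_diff entry_sum entry_single entry_zero vertex_poly_def)
    then show ?thesis
      using rel by (simp add: ideal_zero)
  next
    case False
    have v: "v \<in> verts E" "m < n"
      using ghost_edge(2) by (auto simp: p regular_verts_def)
    then have ab: "a = Inr (v, m)" "b = Inr (v, m)"
      using ghost_edge False by (simp_all add: p out_arcs_head_graph)
    have weight: "vertex_weight E' w' p = 1"
      using v False by (simp add: p vertex_weight_head_graph)
    \<comment> \<open>The ghost comes first and climbs from index m - 1 to m before the edge
      returns, hence the position (m - 1, m - 1) instead of (m, m).\<close>
    have "entry i j r =
        (if i = m - 1 \<and> j = m - 1 then word [Vertex v, Vertex v] - word [Vertex v] else 0)"
      using v False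
      by (auto simp: ghost_edge(1) weight ab edge_poly_def ghost_poly_def vertex_poly_def
          word_times_word entry_diff entry_single)
    then show ?thesis
      using Vertex_Vertex[OF v(1)] by (simp add: ideal_zero)
  qed
qed

text \<open>The polynomials all of whose entries lie in \<open>I\<close> form an ideal by
  \<open>entry_mult\<close>, and it contains the relations. All \<open>i\<close> and
  \<open>j\<close> are taken together since a product mixes the entries.\<close>

lemma entry_ideal:
  assumes "x \<in> I'"
  shows "entry i j x \<in> I"
proof -
  let ?K = "{x \<in> C'. \<forall>i j. entry i j x \<in> I}"
  have "entry i j (a * x) \<in> I" "entry i j (x * a) \<in> I" if "a \<in> C'" "x \<in> ?K" for a x i j
    using that by (auto simp: entry_mult intro: ideal_sum ideal_lmult ideal_rmult entry_closed)
  then have "algebra_ideal (free_algebra (gens E' w')) ?K"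
    unfolding algebra_ideal_def
    by (auto simp: entry_zero entry_add entry_scale ideal_zero free_algebra_zero
        intro: free_algebra_add free_algebra_mult free_algebra_scale ideal_add ideal_scale)
  moreover have "wlpa_relations E' w' \<subseteq> ?K"
    using wlpa_relations_subset[OF heads.row_finite_weighted_graph_axioms] entry_relation by blast
  ultimately have "I' \<subseteq> ?K"
    unfolding wlpa_ideal_def by (rule generated_algebra_ideal_minimal)
  then show ?thesis
    using assms by blast
qed

subsection \<open>The inverse\<close>

text \<open>Induced by the embedding of \<open>E\<close> at index 0; it agrees with
  \<open>expand 0 0\<close> below.\<close>

definition lift_poly :: "('k, 'v, 'e) gen_poly \<Rightarrow> ('k, 'v \<times> nat, 'e + 'v \<times> nat) gen_poly" where
  "lift_poly = linear_extension (\<lambda>u. word (map lift_gen u))"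

lemma lift_poly_single: "lift_poly (Poly_Mapping.single u c) = Poly_Mapping.single (map lift_gen u) c"
  by (simp add: lift_poly_def scale_word)

lemma lift_poly_zero: "lift_poly 0 = 0"
  by (simp add: lift_poly_def)

lemma lift_poly_diff: "lift_poly (p - q) = lift_poly p - lift_poly q"
  by (simp add: lift_poly_def linear_extension_diff)

lemma lift_poly_sum: "lift_poly (\<Sum>x\<in>A. f x) = (\<Sum>x\<in>A. lift_poly (f x))"
  by (simp add: lift_poly_def linear_extension_sum)

lemma lift_poly_edge_ghost:
  "lift_poly (edge_poly w e i * ghost_poly w f j) = edge_poly w' (Inl e) i * ghost_poly w' (Inl f) j"
  by (simp add: edge_poly_def ghost_poly_def word_times_word lift_poly_single lift_poly_zero)

lemma lift_poly_ghost_edge: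
  "lift_poly (ghost_poly w e i * edge_poly w f j) = ghost_poly w' (Inl e) i * edge_poly w' (Inl f) j"
  by (simp add: edge_poly_def ghost_poly_def word_times_word lift_poly_single lift_poly_zero)

text \<open>A vertex v and its copy v_0 have corresponding outgoing edges, the same weight and the
  same regularity, so each relation is carried to the corresponding relation at index 0.\<close>

lemma lift_relation:
  assumes "r \<in> wlpa_relations E w"
  shows "lift_poly r \<in> I'"
  using assms
proof cases
  case (vertices u v)
  have "vertex_poly (u, 0) * vertex_poly (v, 0) - (if (u, 0 :: nat) = (v, 0) then vertex_poly (u, 0) else 0) \<in> I'"
    by (rule heads.relations_subset_ideal, rule wlpa_relations.vertices) (use vertices n_pos in auto)
  moreover have "lift_poly r =
      vertex_poly (u, 0) * vertex_poly (v, 0) - (if (u, 0 :: nat) = (v, 0) then vertex_poly (u, 0) else 0)"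
    by (simp add: vertices(1) vertex_poly_def word_times_word lift_poly_diff lift_poly_single lift_poly_zero)
  ultimately show ?thesis
    by (simp only:)
next
  case (tail_edge e k)
  then have "lift_gen (Edge e k) \<in> gens E' w'"
    by (intro lift_in_gens) (auto simp: gens_def)
  from heads.gen_src_gen[OF this] show ?thesis
    using tail_edge
    by (simp add: vertex_poly_def edge_poly_def word_times_word lift_poly_diff lift_poly_single)
next
  case (edge_head e k)
  then have "lift_gen (Edge e k) \<in> gens E' w'"
    by (intro lift_in_gens) (auto simp: gens_def)
  from heads.gen_gen_rng[OF this] show ?thesis
    using edge_head
    by (simp add: vertex_poly_def edge_poly_def word_times_word lift_poly_diff lift_poly_single)
next
  case (head_ghost e k)
  then have "lift_gen (Ghost e k) \<in> gens E' w'"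
    by (intro lift_in_gens) (auto simp: gens_def)
  from heads.gen_src_gen[OF this] show ?thesis
    using head_ghost
    by (simp add: vertex_poly_def ghost_poly_def word_times_word lift_poly_diff lift_poly_single)
next
  case (ghost_tail e k)
  then have "lift_gen (Ghost e k) \<in> gens E' w'"
    by (intro lift_in_gens) (auto simp: gens_def)
  from heads.gen_gen_rng[OF this] show ?thesis
    using ghost_tail
    by (simp add: vertex_poly_def ghost_poly_def word_times_word lift_poly_diff lift_poly_single)
next
  case (edge_ghost v i j)
  have weight: "vertex_weight E' w' (v, 0) = vertex_weight E w v"
    by (simp add: vertex_weight_head_graph)
  have "(\<Sum>a\<in>out_arcs E' (v, 0). edge_poly w' a i * ghost_poly w' a j)
      - (if i = j then vertex_poly (v, 0) else 0) \<in> I'"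
    using edge_ghost n_pos
    by (intro heads.relations_subset_ideal wlpa_relations.edge_ghost)
      (simp_all add: regular_verts_head_graph weight)
  moreover have "lift_poly r = (\<Sum>a\<in>out_arcs E' (v, 0). edge_poly w' a i * ghost_poly w' a j)
      - (if i = j then vertex_poly (v, 0) else 0)"
    by (simp add: edge_ghost(1) out_arcs_head_graph sum.reindex lift_poly_diff lift_poly_sum
        lift_poly_edge_ghost lift_poly_single lift_poly_zero vertex_poly_def)
  ultimately show ?thesis
    by (simp only:)
next
  case (ghost_edge v e f)
  have weight: "vertex_weight E' w' (v, 0) = vertex_weight E w v"
    by (simp add: vertex_weight_head_graph)
  have "(\<Sum>i\<in>{1..vertex_weight E' w' (v, 0)}. ghost_poly w' (Inl e) i * edge_poly w' (Inl f) i)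
      - (if Inl e = (Inl f :: 'e + 'v \<times> nat) then vertex_poly (head E' (Inl e)) else 0) \<in> I'"
    using ghost_edge n_pos
    by (intro heads.relations_subset_ideal wlpa_relations.ghost_edge)
      (simp_all add: regular_verts_head_graph out_arcs_head_graph)
  moreover have "lift_poly r =
      (\<Sum>i\<in>{1..vertex_weight E' w' (v, 0)}. ghost_poly w' (Inl e) i * edge_poly w' (Inl f) i)
      - (if Inl e = (Inl f :: 'e + 'v \<times> nat) then vertex_poly (head E' (Inl e)) else 0)"
    by (simp add: ghost_edge(1) weight lift_poly_diff lift_poly_sum
        lift_poly_ghost_edge lift_poly_single lift_poly_zero vertex_poly_def)
  ultimately show ?thesis
    by (simp only:)
qed

text \<open>The two paths are read off from the first and the last generator, whether or not the
  word is a walk, so the map extends linearly to the whole free algebra.\<close>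

definition expand_word :: "nat \<Rightarrow> nat \<Rightarrow> ('v, 'e) gen list \<Rightarrow> ('v \<times> nat, 'e + 'v \<times> nat) gen list" where
  "expand_word i j u =
    head_path (gen_src E (hd u)) i @ map lift_gen u @ head_copath (gen_rng E (last u)) j"

definition expand :: "nat \<Rightarrow> nat \<Rightarrow> ('k, 'v, 'e) gen_poly \<Rightarrow> ('k, 'v \<times> nat, 'e + 'v \<times> nat) gen_poly" where
  "expand i j = linear_extension (\<lambda>u. word (expand_word i j u))"

lemma expand_single: "expand i j (Poly_Mapping.single u c) = Poly_Mapping.single (expand_word i j u) c"
  by (simp add: expand_def scale_word)

lemma expand_zero: "expand i j 0 = 0"
  by (simp add: expand_def)

lemma expand_add: "expand i j (p + q) = expand i j p + expand i j q"
  by (simp add: expand_def linear_extension_add)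

lemma expand_scale: "expand i j (Poly_Mapping.single 0 c * p) = Poly_Mapping.single 0 c * expand i j p"
  by (simp add: expand_def linear_extension_scale)

lemma set_head_path: "v \<in> verts E \<Longrightarrow> i < n \<Longrightarrow> set (head_path v i) \<subseteq> gens E' w'"
  by (induction i) (auto simp: gens_def)

lemma set_head_copath: "v \<in> verts E \<Longrightarrow> i < n \<Longrightarrow> set (head_copath v i) \<subseteq> gens E' w'"
  by (induction i) (auto simp: gens_def)

lemma expand_word_in_words:
  assumes "u \<in> words (gens E w)" "i < n" "j < n"
  shows "expand_word i j u \<in> words (gens E' w')"
  using assms map_lift_in_words[OF assms(1)]
    set_head_path[OF gen_src_in_verts[OF hd_in_gens[OF assms(1)]] assms(2)]
    set_head_copath[OF gen_rng_in_verts[OF last_in_gens[OF assms(1)]] assms(3)]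
  by (auto simp: expand_word_def)

lemma expand_closed: "p \<in> C \<Longrightarrow> i < n \<Longrightarrow> j < n \<Longrightarrow> expand i j p \<in> C'"
  unfolding expand_def
  by (erule linear_extension_closed) (intro free_algebra_single expand_word_in_words)

text \<open>On polynomials whose words share both ends, the two attached paths are constant and can
  be pulled out; in general they vary with the word.\<close>

lemma expand_homogeneous:
  assumes "\<And>u. u \<in> Poly_Mapping.keys p \<Longrightarrow> gen_src E (hd u) = s \<and> gen_rng E (last u) = t"
  shows "expand i j p = word (head_path s i) * lift_poly p * word (head_copath t j)"
  unfolding expand_def lift_poly_def
  by (rule linear_extension_sandwich) (simp add: assms expand_word_def word_times_word)

text \<open>Index 0 attaches the empty path, so nothing has to cancel at the junction; the outer
  paths depend only on the first generator of the left word and the last one of the right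
  word.\<close>

lemma expand_mult:
  assumes "p \<in> C" "q \<in> C"
  shows "expand i j (p * q) = expand i 0 p * expand 0 j q"
  using assms(2)
proof (induction q rule: free_algebra_induct)
  case (single v d)
  from assms(1) show ?case
  proof (induction p rule: free_algebra_induct)
    case (single u c)
    show ?case
      using single \<open>v \<in> words (gens E w)\<close>
      by (simp add: mult_single plus_list_def expand_single expand_word_def)
  qed (simp_all add: expand_zero expand_add distrib_right)
qed (simp_all add: expand_zero expand_add distrib_left)

text \<open>Makes \<open>expand_homogeneous\<close> applicable to relations. When a Kronecker delta
  vanishes, the term that could have other ends is gone.\<close>

lemma relation_homogeneous:
  fixes r :: "('k, 'v, 'e) gen_poly"
  assumes "r \<in> wlpa_relations E w"
  shows "\<exists>s\<in>verts E. \<exists>t\<in>verts E. \<forall>u\<in>Poly_Mapping.keys r. gen_src E (hd u) = s \<and> gen_rng E (last u) = t"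
proof -
  \<comment> \<open>Membership looks only at the ends of the words in the support, so
    \<open>H s t\<close> contains 0 and is closed under sums and differences.\<close>
  define H :: "'v \<Rightarrow> 'v \<Rightarrow> ('k, 'v, 'e) gen_poly set" where
    "H s t = {r. \<forall>u\<in>Poly_Mapping.keys r. gen_src E (hd u) = s \<and> gen_rng E (last u) = t}" for s t
  have zero: "0 \<in> H s t" for s t
    by (simp add: H_def)
  have diff: "p - q \<in> H s t" if "p \<in> H s t" "q \<in> H s t" for p q s t
    using that keys_diff[of p q] unfolding H_def by blast
  have add: "p + q \<in> H s t" if "p \<in> H s t" "q \<in> H s t" for p q s t
    using that Poly_Mapping.keys_add[of p q] unfolding H_def by blast
  have sum: "(\<Sum>x\<in>A. f x) \<in> H s t" if "\<And>x. x \<in> A \<Longrightarrow> f x \<in> H s t" for f s t and A :: "'x set"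
    using that by (induction A rule: infinite_finite_induct) (simp_all add: zero add)
  have word: "word u \<in> H (gen_src E (hd u)) (gen_rng E (last u))" for u
    by (simp add: H_def)
  have edge_ghost: "edge_poly w e i * ghost_poly w e j \<in> H (tail E e) (tail E e)" for e i j
    using word[of "[Edge e i, Ghost e j]"] by (simp add: edge_poly_def ghost_poly_def word_times_word zero)
  have ghost_edge: "ghost_poly w e i * edge_poly w f i \<in> H (head E e) (head E f)" for e f i
    using word[of "[Ghost e i, Edge f i]"] by (simp add: edge_poly_def ghost_poly_def word_times_word zero)
  have "\<exists>s\<in>verts E. \<exists>t\<in>verts E. r \<in> H s t"
    using assms
  proof cases
    case (vertices u v)
    have "r \<in> H u v"
      using word[of "[Vertex u, Vertex v]"] word[of "[Vertex u]"]
      by (auto simp: vertices(1) vertex_poly_def word_times_word zero intro: diff)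
    then show ?thesis
      using vertices by blast
  next
    case (tail_edge e i)
    have "r \<in> H (tail E e) (head E e)"
      using word[of "[Vertex (tail E e), Edge e i]"] word[of "[Edge e i]"] tail_edge
      by (simp add: vertex_poly_def edge_poly_def word_times_word diff)
    then show ?thesis
      using tail_edge by (meson head_in_verts tail_in_verts)
  next
    case (edge_head e i)
    have "r \<in> H (tail E e) (head E e)"
      using word[of "[Edge e i, Vertex (head E e)]"] word[of "[Edge e i]"] edge_head
      by (simp add: vertex_poly_def edge_poly_def word_times_word diff)
    then show ?thesis
      using edge_head by (meson head_in_verts tail_in_verts)
  next
    case (head_ghost e i)
    have "r \<in> H (head E e) (tail E e)"
      using word[of "[Vertex (head E e), Ghost e i]"] word[of "[Ghost e i]"] head_ghost
      by (simp add: vertex_poly_def ghost_poly_def word_times_word diff)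
    then show ?thesis
      using head_ghost by (meson head_in_verts tail_in_verts)
  next
    case (ghost_tail e i)
    have "r \<in> H (head E e) (tail E e)"
      using word[of "[Ghost e i, Vertex (tail E e)]"] word[of "[Ghost e i]"] ghost_tail
      by (simp add: vertex_poly_def ghost_poly_def word_times_word diff)
    then show ?thesis
      using ghost_tail by (meson head_in_verts tail_in_verts)
  next
    case (edge_ghost v i j)
    have "(if i = j then vertex_poly v else 0) \<in> H v v"
      using word[of "[Vertex v]"] by (simp add: vertex_poly_def zero)
    moreover have "(\<Sum>e\<in>out_arcs E v. edge_poly w e i * ghost_poly w e j) \<in> H v v"
      using \<open>\<And>j i e. edge_poly w e i * ghost_poly w e j \<in> H (tail E e) (tail E e)\<close>
      by (intro sum) auto
    ultimately have "r \<in> H v v"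
      unfolding edge_ghost(1) by (rule diff[rotated])
    then show ?thesis
      using edge_ghost(2) unfolding regular_verts_def by blast
  next
    case (ghost_edge v e f)
    have "(if e = f then vertex_poly (head E e) else 0) \<in> H (head E e) (head E f)"
      using word[of "[Vertex (head E e)]"] by (auto simp: vertex_poly_def zero)
    moreover have "(\<Sum>i\<in>{1..vertex_weight E w v}. ghost_poly w e i * edge_poly w f i)
        \<in> H (head E e) (head E f)"
      by (intro sum \<open>\<And>i f e. ghost_poly w e i * edge_poly w f i \<in> H (head E e) (head E f)\<close>)
    ultimately have "r \<in> H (head E e) (head E f)"
      unfolding ghost_edge(1) by (rule diff[rotated])
    then show ?thesis
      using ghost_edge by (meson head_in_verts in_out_arcs_conv)
  qed
  then show ?thesis
    by (simp add: H_def)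
qed

lemma expand_relation:
  assumes r: "r \<in> wlpa_relations E w" and "i < n" "j < n"
  shows "expand i j r \<in> I'"
proof -
  obtain s t where st: "s \<in> verts E" "t \<in> verts E"
    and hom: "\<And>u. u \<in> Poly_Mapping.keys r \<Longrightarrow> gen_src E (hd u) = s \<and> gen_rng E (last u) = t"
    using relation_homogeneous[OF r] by blast
  have "word (head_path s i) * lift_poly r * word (head_copath t j) \<in> I'"
    using st assms by (intro heads.ideal_word_mult lift_relation set_head_path set_head_copath)
  then show ?thesis
    by (simp only: expand_homogeneous[OF hom])
qed

text \<open>As in \<open>entry_ideal\<close>, the polynomials with all expansions in
  \<open>I'\<close> form an ideal containing the relations; absorption comes from
  \<open>expand_mult\<close>.\<close>

lemma expand_ideal:
  assumes "x \<in> I" "i < n" "j < n"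
  shows "expand i j x \<in> I'"
proof -
  let ?K = "{x \<in> C. \<forall>i<n. \<forall>j<n. expand i j x \<in> I'}"
  have "expand i j (a * x) \<in> I'" "expand i j (x * a) \<in> I'"
    if "a \<in> C" "x \<in> ?K" "i < n" "j < n" for a x i j
  proof -
    \<comment> \<open>Index 0, at which \<open>expand_mult\<close> splits, is admissible because
      \<open>n\<close> is positive.\<close>
    have x: "x \<in> C" "expand i 0 x \<in> I'" "expand 0 j x \<in> I'" and "0 < n"
      using that n_pos by auto
    then show "expand i j (a * x) \<in> I'" "expand i j (x * a) \<in> I'"
      unfolding expand_mult[OF that(1) x(1)] expand_mult[OF x(1) that(1)]
      using that by (auto intro: heads.ideal_lmult[OF expand_closed] heads.ideal_rmult[OF expand_closed])
  qed
  then have "algebra_ideal (free_algebra (gens E w)) ?K"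
    unfolding algebra_ideal_def
    by (auto simp: expand_zero expand_add expand_scale heads.ideal_zero free_algebra_zero
        intro: free_algebra_add free_algebra_mult free_algebra_scale heads.ideal_add heads.ideal_scale)
  moreover have "wlpa_relations E w \<subseteq> ?K"
    using wlpa_relations_subset[OF row_finite_weighted_graph_axioms] expand_relation by blast
  ultimately have "I \<subseteq> ?K"
    unfolding wlpa_ideal_def by (rule generated_algebra_ideal_minimal)
  then show ?thesis
    using assms by blast
qed

section \<open>Cancellation along a head\<close>

lemma
  assumes "v \<in> verts E" "Suc k < n"
  shows new_Edge_Ghost: "word [Edge (Inr (v, Suc k)) 1, Ghost (Inr (v, Suc k)) 1] - word [Vertex (v, Suc k)] \<in> I'"
    and new_Ghost_Edge: "word [Ghost (Inr (v, Suc k)) 1, Edge (Inr (v, Suc k)) 1] - word [Vertex (v, k)] \<in> I'"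
proof -
  let ?p = "(v, Suc k)"
  \<comment> \<open>The vertex \<open>?p\<close> emits one edge, of weight 1, so both sum relations
    reduce to a single product.\<close>
  have out: "out_arcs E' ?p = {Inr ?p}"
    using assms by (simp add: out_arcs_head_graph)
  then have reg: "?p \<in> regular_verts E'"
    using assms by (simp add: regular_verts_def)
  have weight: "vertex_weight E' w' ?p = 1"
    using assms by (simp add: vertex_weight_head_graph)
  show "word [Edge (Inr ?p) 1, Ghost (Inr ?p) 1] - word [Vertex ?p] \<in> I'"
    using heads.relations_subset_ideal[OF wlpa_relations.edge_ghost[OF reg, of 1 w' 1]]
    by (simp add: out weight edge_poly_def ghost_poly_def vertex_poly_def word_times_word)
  show "word [Ghost (Inr ?p) 1, Edge (Inr ?p) 1] - word [Vertex (v, k)] \<in> I'"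
    using heads.relations_subset_ideal[OF wlpa_relations.ghost_edge[OF reg, of "Inr ?p" "Inr ?p" w']]
    by (simp add: out weight edge_poly_def ghost_poly_def vertex_poly_def word_times_word)
qed

lemma gen_src_hd_head_path:
  "gen_src E' (hd x) = (v, 0) \<Longrightarrow> gen_src E' (hd (head_path v k @ x)) = (v, k)"
  by (cases k) auto

text \<open>The innermost pair, a ghost and its edge at the top of the head, cancels to a vertex
  that the following word absorbs. The factor \<open>x\<close> leaves a nonempty word when both
  paths have vanished.\<close>

lemma copath_path:
  assumes v: "v \<in> verts E" and "k < n"
    and x: "x \<in> words (gens E' w')" "gen_src E' (hd x) = (v, 0)"
  shows "word (head_copath v k @ head_path v k @ x) - word x \<in> I'"
  using \<open>k < n\<close>
proof (induction k)
  case 0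
  show ?case by (simp add: heads.ideal_zero)
next
  case (Suc k)
  let ?a = "Inr (v, Suc k)" and ?P = "head_path v k @ x" and ?Q = "head_copath v k"
  have sets: "set ?P \<subseteq> gens E' w'" "set ?Q \<subseteq> gens E' w'"
    using set_head_path[OF v, of k] set_head_copath[OF v, of k] x Suc.prems by auto
  have "word (?Q @ [Ghost ?a 1, Edge ?a 1] @ ?P) - word (?Q @ [Vertex (v, k)] @ ?P) \<in> I'"
    using heads.word_cong_context[OF new_Ghost_Edge[OF v Suc.prems] sets(2,1)] .
  moreover have "word (Vertex (v, k) # ?P) - word ?P \<in> I'"
    using heads.word_src[of ?P] sets x by (simp add: gen_src_hd_head_path)
  from heads.word_cong_context[OF this sets(2), of "[]"]
  have "word (?Q @ [Vertex (v, k)] @ ?P) - word (?Q @ ?P) \<in> I'"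
    by simp
  moreover have "word (?Q @ ?P) - word x \<in> I'"
    using Suc by simp
  ultimately have "word (?Q @ [Ghost ?a 1, Edge ?a 1] @ ?P) - word x \<in> I'"
    using heads.ideal_diff_trans by blast
  then show ?case
    by simp
qed

text \<open>Here the outermost pair is peeled off. The middle vertex is what the expansion of a
  vertex carries there, and it keeps the word nonempty at \<open>k = 0\<close>.\<close>

lemma path_copath:
  assumes v: "v \<in> verts E" and "k < n"
  shows "word (head_path v k @ [Vertex (v, 0)] @ head_copath v k) - word [Vertex (v, k)] \<in> I'"
  using \<open>k < n\<close>
proof (induction k)
  case 0
  show ?case by (simp add: heads.ideal_zero)
next
  case (Suc k)
  let ?e = "Edge (Inr (v, Suc k)) 1" and ?g = "Ghost (Inr (v, Suc k)) 1"
    and ?R = "head_path v k @ [Vertex (v, 0)] @ head_copath v k"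
  have mem: "?e \<in> gens E' w'" "?g \<in> gens E' w'"
    using v Suc.prems by (auto simp: gens_def)
  have "word ([?e] @ ?R @ [?g]) - word ([?e] @ [Vertex (v, k)] @ [?g]) \<in> I'"
    using Suc mem by (intro heads.word_cong_context) auto
  moreover have "word ([?e] @ [Vertex (v, k)] @ [?g]) - word [?e, ?g] \<in> I'"
    using heads.word_cong_context[OF heads.gen_gen_rng[OF mem(1)], of "[]" "[?g]"] mem by simp
  moreover have "word [?e, ?g] - word [Vertex (v, Suc k)] \<in> I'"
    by (rule new_Edge_Ghost[OF v Suc.prems])
  ultimately have "word ([?e] @ ?R @ [?g]) - word [Vertex (v, Suc k)] \<in> I'"
    using heads.ideal_diff_trans by blast
  then show ?case
    by simp
qed

section \<open>Collapsing a word and expanding it again\<close>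

abbreviation gen_start :: "('v \<times> nat, 'e + 'v \<times> nat) gen \<Rightarrow> nat" where
  "gen_start g \<equiv> snd (gen_src E' g)"

abbreviation gen_end :: "('v \<times> nat, 'e + 'v \<times> nat) gen \<Rightarrow> nat" where
  "gen_end g \<equiv> snd (gen_rng E' g)"

lemma gen_start_less: "g \<in> gens E' w' \<Longrightarrow> gen_start g < n"
  using heads.gen_src_in_verts[of g] by (simp add: mem_Times_iff)

lemma gen_end_less: "g \<in> gens E' w' \<Longrightarrow> gen_end g < n"
  using heads.gen_rng_in_verts[of g] by (simp add: mem_Times_iff)

text \<open>Old generators are reproduced literally. A new edge or ghost comes back with a path and
  its star beside it, which \<open>path_copath\<close> reduces to a vertex that \<open>g\<close>
  absorbs.\<close>

lemma expand_base_gen: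
  assumes "g \<in> gens E' w'"
  shows "word (expand_word (gen_start g) (gen_end g) [base_gen g]) - word [g] \<in> I'"
  using assms
proof (cases rule: heads_gens_cases)
  case (Vertex v i)
  then show ?thesis
    using path_copath[of v i] by (simp add: expand_word_def)
next
  case (Edge_new v i)
  have "word ([g] @ (head_path v i @ [Vertex (v, 0)] @ head_copath v i) @ []) - word ([g] @ [Vertex (v, i)] @ []) \<in> I'"
    using path_copath[of v i] Edge_new assms by (intro heads.word_cong_context) auto
  moreover have "word ([g] @ [Vertex (v, i)] @ []) - word [g] \<in> I'"
    using heads.gen_gen_rng[OF assms] Edge_new by simp
  ultimately have "word ([g] @ (head_path v i @ [Vertex (v, 0)] @ head_copath v i) @ []) - word [g] \<in> I'"
    using heads.ideal_diff_trans by blast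
  then show ?thesis
    using Edge_new by (simp add: expand_word_def)
next
  case (Ghost_new v i)
  have "word ([] @ (head_path v i @ [Vertex (v, 0)] @ head_copath v i) @ [g]) - word ([] @ [Vertex (v, i)] @ [g]) \<in> I'"
    using path_copath[of v i] Ghost_new assms by (intro heads.word_cong_context) auto
  moreover have "word ([] @ [Vertex (v, i)] @ [g]) - word [g] \<in> I'"
    using heads.gen_src_gen[OF assms] Ghost_new by simp
  ultimately have "word ([] @ (head_path v i @ [Vertex (v, 0)] @ head_copath v i) @ [g]) - word [g] \<in> I'"
    using heads.ideal_diff_trans by blast
  then show ?thesis
    using Ghost_new by (simp add: expand_word_def)
qed (simp_all add: expand_word_def heads.ideal_zero)

text \<open>Induction on the word: a copath followed by its path is inserted after \<open>g\<close>,
  so that the expansion splits into one of \<open>g\<close> and one of the rest.\<close>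

lemma expand_base_vertex_walk:
  assumes "u \<in> words (gens E' w')" "heads.vertex_walk x u y"
  shows "word (expand_word (gen_start (hd u)) (gen_end (last u)) (map base_gen u)) - word u \<in> I'"
proof -
  have "u \<noteq> []"
    using assms by simp
  then show ?thesis
    using assms
  proof (induction u arbitrary: x rule: list_nonempty_induct)
    case (single g)
    then show ?case
      using expand_base_gen[of g] by simp
  next
    case (cons g u)
    have g: "g \<in> gens E' w'" and u: "u \<in> words (gens E' w')"
      using cons by auto
    \<comment> \<open>The vertex where \<open>g\<close> ends and \<open>u\<close> starts; the detour
      is inserted along its head.\<close>
    define v k where "v = gen_rng E (base_gen g)" and "k = gen_end g"
    have rng: "gen_rng E' g = (v, k)"
      by (simp add: v_def k_def prod_eq_iff fst_gen_rng)
    have "heads.vertex_walk (v, k) u y"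
      using cons.prems(2) rng by simp
    from walk_ends[OF this] cons.hyps have src: "gen_src E' (hd u) = (v, k)"
      by simp
    have vk: "v \<in> verts E" "k < n"
      using heads.gen_rng_in_verts[OF g] by (simp_all add: rng)
    have base_hd: "gen_src E (base_gen (hd u)) = v"
      using src by (simp flip: fst_gen_src[of n])
    let ?D = "expand_word (gen_start (hd u)) (gen_end (last u)) (map base_gen u)"
    let ?G = "expand_word (gen_start g) (gen_end g) [base_gen g]"
    let ?head = "head_path (gen_src E (base_gen g)) (gen_start g) @ [lift_gen (base_gen g)]"
    let ?tail = "map lift_gen (map base_gen u) @ head_copath (gen_rng E (base_gen (last u))) (gen_end (last u))"
    have ends: "gen_start (hd u) < n" "gen_end (last u) < n" "gen_start g < n" "gen_end g < n"
      using g heads.hd_in_gens[OF u] heads.last_in_gens[OF u]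
      by (simp_all add: gen_start_less gen_end_less)
    have D: "?D = head_path v k @ ?tail"
      using u by (simp add: expand_word_def hd_map last_map base_hd src)
    have G: "?G = ?head @ head_copath v k"
      by (simp add: expand_word_def v_def k_def)
    have D_words: "?D \<in> words (gens E' w')"
      using u map_base_in_words ends by (intro expand_word_in_words) auto
    have G_words: "?G \<in> words (gens E' w')"
      using g ends by (intro expand_word_in_words) (auto simp: base_in_gens)
    have tail: "?tail \<in> words (gens E' w')" and head: "set ?head \<subseteq> gens E' w'"
      using D_words G_words u unfolding D G by auto
    have tail_src: "gen_src E' (hd ?tail) = (v, 0)"
      using u by (simp add: hd_map gen_src_lift base_hd)
    \<comment> \<open>The detour goes from v up to v_k and back; \<open>?G\<close> takes its first
      half and \<open>?D\<close> its second.\<close>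
    have "word (?head @ (head_copath v k @ head_path v k @ ?tail) @ []) - word (?head @ ?tail @ []) \<in> I'"
      using copath_path[OF vk tail tail_src] head by (intro heads.word_cong_context) auto
    from heads.ideal_diff_sym[OF this] have 1: "word (?head @ ?tail) - word (?G @ ?D) \<in> I'"
      unfolding D G by simp
    have "word ([] @ ?G @ ?D) - word ([] @ [g] @ ?D) \<in> I'"
      using expand_base_gen[OF g] D_words by (intro heads.word_cong_context) auto
    then have 2: "word (?G @ ?D) - word ([g] @ ?D) \<in> I'"
      by simp
    have "word ?D - word u \<in> I'"
      using cons.prems by (intro cons.IH[OF u, of "gen_rng E' g"]) simp
    then have "word ([g] @ ?D @ []) - word ([g] @ u @ []) \<in> I'"
      using g by (intro heads.word_cong_context) auto
    then have 3: "word ([g] @ ?D) - word (g # u) \<in> I'"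
      by simp
    have "word (?head @ ?tail) - word (g # u) \<in> I'"
      by (rule heads.ideal_diff_trans[OF 1 heads.ideal_diff_trans[OF 2 3]])
    then show ?case
      using cons.hyps by (simp add: expand_word_def last_map)
  qed
qed

text \<open>An index walk may fail to match at the base vertices. Then the word and its expanded
  collapse are both null, and so is their difference.\<close>

lemma expand_base:
  assumes u: "u \<in> words (gens E' w')" and walk: "index_walk i u j"
  shows "word (expand_word i j (map base_gen u)) - word u \<in> I'"
proof -
  have ij: "i = gen_start (hd u)" "j = gen_end (last u)"
    using walk_ends[OF walk] u by simp_all
  show ?thesis
  proof (cases "\<exists>x y. heads.vertex_walk x u y")
    case True
    then show ?thesis
      using expand_base_vertex_walk[OF u] ij by blast
  next
    case False
    then have "word u \<in> I'"
      using u by (intro heads.not_walk_null) auto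
    moreover have "word (map lift_gen (map base_gen u)) \<in> I'"
    proof (rule heads.not_walk_null)
      fix x y
      show "\<not> heads.vertex_walk x (map lift_gen (map base_gen u)) y"
      proof
        assume "heads.vertex_walk x (map lift_gen (map base_gen u)) y"
        then have "walk (\<lambda>g. gen_src E' (lift_gen (base_gen g))) (\<lambda>g. gen_rng E' (lift_gen (base_gen g))) x u y"
          by (simp add: walk_map_list)
        from walk_map[OF this, of fst]
        have "walk (\<lambda>g. fst (gen_src E' g)) (\<lambda>g. fst (gen_rng E' g)) (fst x) u (fst y)"
          by (simp add: gen_src_lift gen_rng_lift fst_gen_src fst_gen_rng)
        \<comment> \<open>The collapsed word supplies a walk in the first coordinates and the
          hypothesis one in the second, so \<open>u\<close> would itself be a walk.\<close>
        with walk have "heads.vertex_walk (fst x, i) u (fst y, j)"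
          by (intro walk_Pair) simp_all
        then show False
          using False by blast
      qed
    qed (rule map_lift_in_words[OF map_base_in_words[OF u]])
    moreover have "set (head_path (gen_src E (hd (map base_gen u))) i) \<subseteq> gens E' w'"
      "set (head_copath (gen_rng E (last (map base_gen u))) j) \<subseteq> gens E' w'"
      using hd_in_gens[OF map_base_in_words[OF u]] last_in_gens[OF map_base_in_words[OF u]]
        heads.hd_in_gens[OF u] heads.last_in_gens[OF u]
      by (simp_all add: ij set_head_path set_head_copath gen_src_in_verts gen_rng_in_verts gen_start_less gen_end_less)
    ultimately show ?thesis
      unfolding expand_word_def by (intro heads.ideal_diff heads.word_null_context)
  qed
qed

text \<open>A word that is an index walk has exactly one nonzero entry, which expands back to it by
  \<open>expand_base\<close>. For any other word all entries vanish, and the word is null as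
  well.\<close>

lemma expand_entry:
  assumes "x \<in> C'"
  shows "(\<Sum>i<n. \<Sum>j<n. expand i j (entry i j x)) - x \<in> I'"
  using assms
proof (induction x rule: free_algebra_induct)
  case zero
  show ?case
    by (simp add: entry_zero expand_zero heads.ideal_zero)
next
  case (add p q)
  from heads.ideal_add[OF add] show ?case
    by (simp add: entry_add expand_add sum.distrib algebra_simps)
next
  case (single u c)
  let ?i = "gen_start (hd u)" and ?j = "gen_end (last u)"
  have scale: "expand i j (entry i j (Poly_Mapping.single u c)) =
      Poly_Mapping.single 0 c * expand i j (entry i j (word u))" for i j
    by (simp add: scale_word flip: entry_scale expand_scale)
  have ends: "?i < n" "?j < n"
    using heads.hd_in_gens[OF single] heads.last_in_gens[OF single]
    by (simp_all add: gen_start_less gen_end_less)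
  have "(\<Sum>i<n. \<Sum>j<n. expand i j (entry i j (word u))) - word u \<in> I'"
  proof (cases "index_walk ?i u ?j")
    case True
    have "index_walk i u j \<longleftrightarrow> i = ?i \<and> j = ?j" for i j
      using True walk_ends[of _ _ i u j] single by auto
    then have "expand i j (entry i j (word u)) =
        (if j = ?j then if i = ?i then word (expand_word i j (map base_gen u)) else 0 else 0)" for i j
      by (simp add: entry_single expand_single expand_zero)
    then have "(\<Sum>i<n. \<Sum>j<n. expand i j (entry i j (word u))) = word (expand_word ?i ?j (map base_gen u))"
      using ends by simp
    then show ?thesis
      using expand_base[OF single True] by simp
  next
    case False
    have none: "\<not> index_walk i u j" for i j
      using False walk_ends[of _ _ i u j] single by auto
    have "word u \<in> I'"
    proof (rule heads.not_walk_null[OF single])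
      fix x y show "\<not> heads.vertex_walk x u y"
        using none walk_map[of _ _ x u y snd] by blast
    qed
    then show ?thesis
      using heads.ideal_uminus by (simp add: entry_single expand_zero none)
  qed
  from heads.ideal_scale[OF this, of c] show ?case
    unfolding scale by (simp add: sum_distrib_left right_diff_distrib scale_word)
qed

section \<open>Expanding a word and reading off its entries\<close>

lemma index_walk_head_path: "index_walk i (head_path v i) 0"
  by (induction i) simp_all

lemma index_walk_head_copath: "index_walk 0 (head_copath v j) j"
  by (induction j) (auto simp: walk_append)

lemma index_walk_lift: "index_walk 0 (map lift_gen u) 0"
  by (induction u) (simp_all add: gen_src_lift gen_rng_lift)

lemma index_walk_expand_word:
  assumes "u \<noteq> []"
  shows "index_walk k (expand_word i j u) l \<longleftrightarrow> k = i \<and> l = j"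
proof -
  have "index_walk i (expand_word i j u) j"
    unfolding expand_word_def walk_append
    using index_walk_head_path index_walk_lift index_walk_head_copath by blast
  moreover have "expand_word i j u \<noteq> []"
    using assms by (simp add: expand_word_def)
  ultimately show ?thesis
    using walk_ends by metis
qed

lemma map_base_head_path: "map base_gen (head_path v i) = replicate i (Vertex v)"
  by (induction i) simp_all

lemma map_base_head_copath: "map base_gen (head_copath v i) = replicate i (Vertex v)"
  by (induction i) (simp_all add: replicate_append_same)

text \<open>A head path of length \<open>i\<close> collapses to \<open>i\<close> copies of its base
  vertex; these are absorbed one by one.\<close>

lemma vertices_word:
  assumes u: "u \<in> words (gens E w)"
  shows "word (replicate i (Vertex (gen_src E (hd u))) @ u) - word u \<in> I"
proof (induction i)
  case 0
  show ?case by (simp add: ideal_zero)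
next
  case (Suc i)
  let ?v = "Vertex (gen_src E (hd u))"
  have v: "?v \<in> gens E w"
    using hd_in_gens[OF u] by (simp add: gen_src_in_verts Vertex_in_gens)
  have "word ([?v] @ (replicate i ?v @ u) @ []) - word ([?v] @ u @ []) \<in> I"
    using Suc v by (intro word_cong_context) auto
  moreover have "word ([?v] @ u @ []) - word u \<in> I"
    using word_src[OF u] by simp
  ultimately have "word ([?v] @ (replicate i ?v @ u) @ []) - word u \<in> I"
    by (rule ideal_diff_trans)
  then show ?case
    by simp
qed

lemma word_vertices:
  assumes u: "u \<in> words (gens E w)"
  shows "word (u @ replicate j (Vertex (gen_rng E (last u)))) - word u \<in> I"
proof (induction j)
  case 0
  show ?case by (simp add: ideal_zero)
next
  case (Suc j)
  let ?v = "Vertex (gen_rng E (last u))"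
  have v: "?v \<in> gens E w"
    using last_in_gens[OF u] by (simp add: gen_rng_in_verts Vertex_in_gens)
  have "word ([] @ (u @ replicate j ?v) @ [?v]) - word ([] @ u @ [?v]) \<in> I"
    using Suc v by (intro word_cong_context) auto
  moreover have "word ([] @ u @ [?v]) - word u \<in> I"
    using word_rng[OF u] by simp
  ultimately have "word ([] @ (u @ replicate j ?v) @ [?v]) - word u \<in> I"
    by (rule ideal_diff_trans)
  then show ?case
    by (simp add: replicate_append_same)
qed

lemma base_expand:
  assumes u: "u \<in> words (gens E w)"
  shows "word (map base_gen (expand_word i j u)) - word u \<in> I"
proof -
  let ?s = "replicate i (Vertex (gen_src E (hd u)))" and ?t = "replicate j (Vertex (gen_rng E (last u)))"
  have "set ?s \<subseteq> gens E w" "set ?t \<subseteq> gens E w"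
    using hd_in_gens[OF u] last_in_gens[OF u]
    by (auto simp: gen_src_in_verts gen_rng_in_verts Vertex_in_gens)
  then have "word (?s @ (u @ ?t) @ []) - word (?s @ u @ []) \<in> I"
    by (intro word_cong_context word_vertices[OF u]) auto
  moreover have "word (?s @ u @ []) - word u \<in> I"
    using vertices_word[OF u] by simp
  ultimately have "word (?s @ (u @ ?t) @ []) - word u \<in> I"
    by (rule ideal_diff_trans)
  moreover have "map base_gen (map lift_gen u) = u"
    by (simp add: base_lift map_idI)
  ultimately show ?thesis
    by (simp add: expand_word_def map_base_head_path map_base_head_copath del: map_map)
qed

text \<open>Expanded words walk from index \<open>i\<close> to \<open>j\<close> and between no other
  indices, so all other entries vanish; at (i, j) \<open>base_expand\<close> recovers
  \<open>x\<close>.\<close>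

lemma entry_expand:
  assumes "x \<in> C"
  shows "entry k l (expand i j x) - (if k = i \<and> l = j then x else 0) \<in> I"
  using assms
proof (induction x rule: free_algebra_induct)
  case zero
  show ?case
    by (simp add: entry_zero expand_zero ideal_zero)
next
  case (add p q)
  have "(if b then p + q else 0) = (if b then p else 0) + (if b then q else 0)" for b
    by simp
  then show ?case
    unfolding expand_add entry_add using ideal_add[OF add] by (simp only: add_diff_add)
next
  case (single u c)
  from ideal_scale[OF base_expand[OF single, of i j], of c] single show ?case
    by (simp add: expand_single entry_single index_walk_expand_word right_diff_distrib scale_word ideal_zero)
qed

subsection \<open>The isomorphism\<close>

text \<open>Defined through an arbitrary representative; by \<open>entry_ideal\<close> the choice
  does not matter.\<close>

definition to_matrix :: "('k, 'v \<times> nat, 'e + 'v \<times> nat) gen_poly set \<Rightarrow> ('k, 'v, 'e) gen_poly set mat" where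
  "to_matrix X = mat n n (\<lambda>(i, j). coset (entry i j (SOME x. x \<in> X)))"

lemma to_matrix_coset: "to_matrix (heads.coset x) = mat n n (\<lambda>(i, j). coset (entry i j x))"
proof -
  have "(SOME y. y \<in> heads.coset x) - x \<in> I'"
    using someI[of "\<lambda>y. y \<in> heads.coset x", OF heads.coset_self] by (simp only: heads.mem_coset)
  then have "coset (entry i j (SOME y. y \<in> heads.coset x)) = coset (entry i j x)" for i j
    unfolding coset_eq_iff entry_diff[symmetric] by (rule entry_ideal)
  then show ?thesis
    by (simp add: to_matrix_def)
qed

lemma to_matrix_closed:
  assumes "x \<in> C'"
  shows "to_matrix (heads.coset x) \<in> carrier (matrix_algebra n quotient)"
  using entry_closed[OF assms]
  by (auto simp: to_matrix_coset matrix_algebra_def carrier_quotient dest!: elements_matD)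

lemma to_matrix_add:
  "to_matrix (heads.coset x \<oplus>\<^bsub>heads.quotient\<^esub> heads.coset y) =
    to_matrix (heads.coset x) \<oplus>\<^bsub>matrix_algebra n quotient\<^esub> to_matrix (heads.coset y)"
  unfolding heads.quotient_add to_matrix_coset
  by (rule eq_matI) (simp_all add: matrix_algebra_def quotient_add entry_add)

lemma to_matrix_scale:
  "to_matrix (c \<odot>\<^bsub>heads.quotient\<^esub> heads.coset x) =
    c \<odot>\<^bsub>matrix_algebra n quotient\<^esub> to_matrix (heads.coset x)"
  unfolding heads.quotient_scale to_matrix_coset
  by (rule eq_matI) (simp_all add: matrix_algebra_def quotient_scale entry_scale)

lemma to_matrix_mult:
  assumes x: "x \<in> C'" and y: "y \<in> C'"
  shows "to_matrix (heads.coset x \<otimes>\<^bsub>heads.quotient\<^esub> heads.coset y) =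
    to_matrix (heads.coset x) \<otimes>\<^bsub>matrix_algebra n quotient\<^esub> to_matrix (heads.coset y)"
proof -
  let ?M = "mat n n (\<lambda>(i, j). coset (entry i j x))" and ?N = "mat n n (\<lambda>(i, j). coset (entry i j y))"
  have "(\<Oplus>\<^bsub>quotient\<^esub>l\<in>{0..<n}. ?M $$ (i, l) \<otimes>\<^bsub>quotient\<^esub> ?N $$ (l, j)) = coset (entry i j (x * y))"
    if "i < n" "j < n" for i j
  proof -
    have "(\<Oplus>\<^bsub>quotient\<^esub>l\<in>{0..<n}. ?M $$ (i, l) \<otimes>\<^bsub>quotient\<^esub> ?N $$ (l, j)) =
        (\<Oplus>\<^bsub>quotient\<^esub>l\<in>{0..<n}. coset (entry i l x * entry l j y))"
      by (rule abelian_monoid.finsum_cong'[OF abelian_monoid_quotient])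
        (use that x y in \<open>auto simp: quotient_mult entry_closed carrier_quotient intro!: free_algebra_mult\<close>)
    also have "\<dots> = coset (\<Sum>l\<in>{0..<n}. entry i l x * entry l j y)"
      by (rule quotient_finsum) (use x y in \<open>auto intro!: free_algebra_mult entry_closed\<close>)
    finally show ?thesis
      by (simp add: entry_mult[OF x y] atLeast0LessThan)
  qed
  then show ?thesis
    unfolding heads.quotient_mult[OF x y] to_matrix_coset
    by (intro eq_matI) (simp_all add: matrix_algebra_def)
qed

text \<open>All entries of x - y lie in \<open>I\<close>, hence their expansions lie in
  \<open>I'\<close>; by \<open>expand_entry\<close> these add up to x - y modulo
  \<open>I'\<close>.\<close>

lemma to_matrix_inj:
  assumes "x \<in> C'" "y \<in> C'" "to_matrix (heads.coset x) = to_matrix (heads.coset y)"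
  shows "heads.coset x = heads.coset y"
proof -
  have "coset (entry i j x) = coset (entry i j y)" if "i < n" "j < n" for i j
    using arg_cong[OF assms(3), of "\<lambda>M. M $$ (i, j)"] that by (simp add: to_matrix_coset)
  then have "entry i j (x - y) \<in> I" if "i < n" "j < n" for i j
    using that by (simp add: coset_eq_iff entry_diff)
  then have "(\<Sum>i<n. \<Sum>j<n. expand i j (entry i j (x - y))) \<in> I'"
    by (intro heads.ideal_sum expand_ideal) simp_all
  with heads.ideal_diff_sym[OF expand_entry[OF free_algebra_diff[OF assms(1,2)]]]
  have "x - y \<in> I'"
    using heads.ideal_add by fastforce
  then show ?thesis
    by (simp only: heads.coset_eq_iff)
qed

lemma to_matrix_surj:
  assumes "M \<in> carrier (matrix_algebra n quotient)"
  shows "\<exists>x\<in>C'. to_matrix (heads.coset x) = M"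
proof -
  have M: "M \<in> carrier_mat n n"
    using assms by (simp add: matrix_algebra_def)
  have "\<exists>m\<in>C. M $$ (i, j) = coset m" if "i < n" "j < n" for i j
  proof -
    have "M $$ (i, j) \<in> carrier quotient"
      using assms that by (auto simp: matrix_algebra_def)
    then show ?thesis
      by (auto simp: carrier_quotient)
  qed
  then obtain m where m: "\<And>i j. i < n \<Longrightarrow> j < n \<Longrightarrow> m i j \<in> C \<and> M $$ (i, j) = coset (m i j)"
    by metis
  \<comment> \<open>A preimage: expand a representative of each entry of \<open>M\<close> at its own
    position.\<close>
  define x where "x = (\<Sum>i<n. \<Sum>j<n. expand i j (m i j))"
  have "x \<in> C'"
    unfolding x_def by (intro free_algebra_sum expand_closed) (simp_all add: m)
  moreover have "coset (entry k l x) = M $$ (k, l)" if kl: "k < n" "l < n" for k l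
  proof -
    have "(\<Sum>i<n. \<Sum>j<n. entry k l (expand i j (m i j)) - (if k = i \<and> l = j then m i j else 0)) \<in> I"
      by (intro ideal_sum entry_expand) (simp_all add: m)
    moreover have "(\<Sum>i<n. \<Sum>j<n. if k = i \<and> l = j then m i j else 0) = m k l"
    proof -
      \<comment> \<open>The conjunction is split into nested conditionals so that each sum picks out
        one index.\<close>
      have "(\<Sum>i<n. \<Sum>j<n. if k = i \<and> l = j then m i j else 0) =
          (\<Sum>i<n. \<Sum>j<n. if l = j then if k = i then m i j else 0 else 0)"
        by (intro sum.cong) auto
      then show ?thesis
        using kl by simp
    qed
    ultimately have "entry k l x - m k l \<in> I"
      by (simp add: x_def entry_sum sum_subtractf)
    then show ?thesis
      using m[OF kl] by (simp add: coset_eq_iff)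
  qed
  then have "to_matrix (heads.coset x) = M"
    unfolding to_matrix_coset using M by (intro eq_matI) auto
  ultimately show ?thesis
    by blast
qed

lemma to_matrix_iso: "to_matrix \<in> algebra_iso heads.quotient (matrix_algebra n quotient)"
proof -
  have "inj_on to_matrix (carrier heads.quotient)"
    unfolding heads.carrier_quotient using to_matrix_inj by (intro inj_onI) (elim imageE, simp only:)
  moreover have "to_matrix ` carrier heads.quotient = carrier (matrix_algebra n quotient)"
    using to_matrix_closed to_matrix_surj by (fastforce simp: heads.carrier_quotient image_iff)
  ultimately show ?thesis
    unfolding algebra_iso_def bij_betw_def
    by (auto simp: heads.carrier_quotient to_matrix_add to_matrix_mult to_matrix_scale)
qed

end

theorem theorem2p14:
  fixes E :: "('v, 'e) pre_digraph" and w :: "'e \<Rightarrow> nat" and n :: nat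
  assumes "row_finite_weighted_graph E w"
    and "1 \<le> n"
  shows "algebra_isomorphic
           (wlpa TYPE('k::field) (head_graph n E) (head_weight w))
           (matrix_algebra n (wlpa TYPE('k) E w))"
proof -
  interpret weighted_leavitt_heads E w "TYPE('k)" n
    by (intro weighted_leavitt_heads.intro weighted_leavitt.intro weighted_leavitt_heads_axioms.intro assms)
  show ?thesis
    using to_matrix_iso unfolding algebra_isomorphic_def wlpa_def wlpa_ideal_def by blast
qed

end
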